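(* Let $A,B\in\mathbb{C}^{2\times2}$ be regular boundary conditions such that $\Delta(A,B)$ generates a contractive $C_0$-semigroup on $L^2([0,\infty))\oplus L^2([0,\infty))$. Let $C$ be a closed convex subset of $\mathbb{C}^2$. Then the semigroup generated by $\Delta(A,B)$ leaves $\mathcal{C}$ invariant provided that the matrix $$\frac{\kappa}{2}\begin{bmatrix} e^{-\kappa|x_1-y_1|}+e^{-\kappa(x_1+y_1)}\sigma_{11}(i\kappa) & e^{-\kappa(x_1+y_2)}\sigma_{12}(i\kappa)\\ e^{-\kappa(x_2+y_1)}\sigma_{21}(i\kappa) & e^{-\kappa|x_2-y_2|}+e^{-\kappa(x_2+y_2)}\sigma_{22}(i\kappa)\end{bmatrix}$$ leaves $C$ invariant for all $\kappa>0$ and all $x_1,x_2,y_1,y_2\in[0,\infty)$, where $\sigma_{ij}(i\kappa)=(\mathfrak{S}(i\kappa;A,B))_{ij}$, $1\le i,j\le2$. In particular, the semigroup generated by $\Delta(A,B)$ is $L^\infty$-contractive provided $I+\mathfrak{S}(i\kappa;A,B)$ leaves $\{\xi\in\mathbb{C}^2:|\xi_1|+|\xi_2|\le1\}$ invariant for all $\kappa>0$.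
   Context: $I$ is the $2\times2$ identity matrix; $L^2([0,\infty))$ consists of complex-valued functions. Operator: for $A,B\in\mathbb{C}^{2\times2}$ with $\operatorname{Rank}(A\ B)=2$ (where $(A\ B)$ is the $2\times4$ block matrix), $\Delta(A,B)$ is the operator in $L^2([0,\infty))\oplus L^2([0,\infty))$ with domain the set of $\psi=(\psi_1,\psi_2)\in H^2([0,\infty))\oplus H^2([0,\infty))$ such that $A\,(\psi_1(0),\psi_2(0))^T+B\,(\psi_1'(0),\psi_2'(0))^T=0$, acting by $\Delta(A,B)\psi=(\psi_1'',\psi_2'')$. Regularity: boundary conditions $A,B$ with $\operatorname{Rank}(A\ B)=2$ are called regular if $A+ikB$ is invertible for some $k\in\mathbb{C}$. Cayley transform: $\mathfrak{S}(k;A,B):=-(A+ikB)^{-1}(A-ikB)$. Given a closed convex $C\subset\mathbb{C}^2$, $\mathcal{C}$ denotes the induced closed convex subset $\{f=(f_1,f_2)\in L^2([0,\infty))\oplus L^2([0,\infty)):(f_1(x),f_2(x))\in C\text{ for a.e. }x\in[0,\infty)\}$. An operator (or matrix) $T$ leaves a set $K$ invariant if $TK\subset K$; a semigroup leaves $K$ invariant if each of its operators does. A semigroup $(T(t))_{t\ge0}$ is $L^\infty$-contractive if $\|T(t)f\|_{\infty}\le\|f\|_\infty$ for all $t\ge0$ and all $f\in (L^2\oplus L^2)\cap(L^\infty\oplus L^\infty)$. *)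

theory Defs
  imports "HOL-Probability.Essential_Supremum"
begin

section \<open>The space \<open>L\<^sup>2([0,\<infinity>))\<close>\<close>

text \<open>Borel representatives suffice: every class of Lebesgue measurable functions contains a Borel
  measurable one.\<close>

definition halfline :: "real measure"
  where "halfline = restrict_space lborel {0..}"

definition square_integrable :: "(real \<Rightarrow> complex) \<Rightarrow> bool"
  where "square_integrable f \<longleftrightarrow>
    f \<in> borel_measurable halfline \<and> integrable halfline (\<lambda>x. (cmod (f x))\<^sup>2)"

definition l2_eq :: "(real \<Rightarrow> complex) \<Rightarrow> (real \<Rightarrow> complex) \<Rightarrow> bool"
  where "l2_eq f g \<longleftrightarrow>
    square_integrable f \<and> square_integrable g \<and> (AE x in halfline. f x = g x)"

lemma square_integrable_measurable [measurable_dest]: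
  "square_integrable f \<Longrightarrow> f \<in> borel_measurable halfline"
  by (simp add: square_integrable_def)

lemma square_integrable_zero: "square_integrable (\<lambda>x. 0)"
  by (simp add: square_integrable_def)

lemma square_integrable_cmult: "square_integrable f \<Longrightarrow> square_integrable (\<lambda>x. c * f x)"
  by (auto simp: square_integrable_def norm_mult power_mult_distrib)

lemma square_integrable_add:
  assumes "square_integrable f" "square_integrable g"
  shows "square_integrable (\<lambda>x. f x + g x)"
proof -
  note [measurable] = assms[THEN square_integrable_measurable]
  have "integrable halfline (\<lambda>x. 2 * (cmod (f x))\<^sup>2 + 2 * (cmod (g x))\<^sup>2)"
    using assms by (simp add: square_integrable_def)
  then have "integrable halfline (\<lambda>x. (cmod (f x + g x))\<^sup>2)"
  proof (rule Bochner_Integration.integrable_bound, goal_cases)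
    case 2
    have "(cmod (f x + g x))\<^sup>2 \<le> 2 * (cmod (f x))\<^sup>2 + 2 * (cmod (g x))\<^sup>2" for x
    proof -
      have "(cmod (f x + g x))\<^sup>2 \<le> (cmod (f x) + cmod (g x))\<^sup>2"
        by (intro power_mono norm_triangle_ineq) simp
      also have "\<dots> \<le> 2 * (cmod (f x))\<^sup>2 + 2 * (cmod (g x))\<^sup>2"
        using sum_squares_bound[of "cmod (f x)" "cmod (g x)"] by (simp add: power2_sum)
      finally show ?thesis .
    qed
    then show ?case by simp
  qed measurable
  then show ?thesis
    by (simp add: square_integrable_def)
qed

lemma square_integrable_uminus: "square_integrable f \<Longrightarrow> square_integrable (\<lambda>x. - f x)"
  using square_integrable_cmult[of f "-1"] by simp

lemma square_integrable_diff:
  "square_integrable f \<Longrightarrow> square_integrable g \<Longrightarrow> square_integrable (\<lambda>x. f x - g x)"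
  using square_integrable_add[of f "\<lambda>x. - g x"] square_integrable_uminus[of g] by simp

lemma square_integrable_inner:
  assumes "square_integrable f" "square_integrable g"
  shows "integrable halfline (\<lambda>x. f x \<bullet> g x)"
proof -
  note [measurable] = assms[THEN square_integrable_measurable]
  have "integrable halfline (\<lambda>x. (cmod (f x))\<^sup>2 + (cmod (g x))\<^sup>2)"
    using assms by (simp add: square_integrable_def)
  then show ?thesis
  proof (rule Bochner_Integration.integrable_bound, goal_cases)
    case 2
    have "\<bar>f x \<bullet> g x\<bar> \<le> (cmod (f x))\<^sup>2 + (cmod (g x))\<^sup>2" for x
    proof -
      have "\<bar>f x \<bullet> g x\<bar> \<le> cmod (f x) * cmod (g x)"
        by (rule Cauchy_Schwarz_ineq2)
      also have "\<dots> \<le> 2 * cmod (f x) * cmod (g x)"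
        by simp
      also have "\<dots> \<le> (cmod (f x))\<^sup>2 + (cmod (g x))\<^sup>2"
        by (rule sum_squares_bound)
      finally show ?thesis .
    qed
    then show ?case by simp
  qed measurable
qed

quotient_type l2 = "real \<Rightarrow> complex" / partial: l2_eq
proof (rule part_equivpI)
  show "\<exists>f. l2_eq f f"
    using square_integrable_zero by (auto simp: l2_eq_def)
  show "symp l2_eq"
    by (auto simp: l2_eq_def symp_def)
  show "transp l2_eq"
    by (auto simp: l2_eq_def transp_def)
qed

text \<open>\<open>rep_l2 f\<close> is an arbitrary representative of the class \<open>f\<close>; below it only
  occurs in contexts that are insensitive to changes on null sets.\<close>

lemma l2_eq_rep: "l2_eq (rep_l2 f) (rep_l2 f)"
  by (rule Quotient3_rep_reflp[OF Quotient3_l2])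

lemma square_integrable_rep: "square_integrable (rep_l2 f)"
  using l2_eq_rep[of f] by (simp add: l2_eq_def)

lemma rep_l2_measurable [measurable]: "rep_l2 f \<in> borel_measurable halfline"
  by (rule square_integrable_measurable[OF square_integrable_rep])

lemma rep_abs_l2:
  assumes "square_integrable f"
  shows "AE x in halfline. rep_l2 (abs_l2 f) x = f x"
  using rep_abs_rsp_left[OF Quotient3_l2, of f f] assms by (auto simp: l2_eq_def)

lemma l2_eqI:
  assumes "AE x in halfline. rep_l2 f x = rep_l2 g x"
  shows "f = g"
  using Quotient3_rel_rep[OF Quotient3_l2, of f g] assms square_integrable_rep
  by (auto simp: l2_eq_def)

instantiation l2 :: real_inner
begin

lift_definition zero_l2 :: l2 is "\<lambda>x. 0"
  by (simp add: l2_eq_def square_integrable_zero)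

lift_definition plus_l2 :: "l2 \<Rightarrow> l2 \<Rightarrow> l2" is "\<lambda>f g x. f x + g x"
  by (auto simp: l2_eq_def square_integrable_add)

lift_definition minus_l2 :: "l2 \<Rightarrow> l2 \<Rightarrow> l2" is "\<lambda>f g x. f x - g x"
  by (auto simp: l2_eq_def square_integrable_diff)

lift_definition uminus_l2 :: "l2 \<Rightarrow> l2" is "\<lambda>f x. - f x"
  by (auto simp: l2_eq_def square_integrable_uminus)

lift_definition scaleR_l2 :: "real \<Rightarrow> l2 \<Rightarrow> l2" is "\<lambda>r f x. complex_of_real r * f x"
  by (auto simp: l2_eq_def square_integrable_cmult)

text \<open>The real part of the usual scalar product; it induces the same norm.\<close>

lift_definition inner_l2 :: "l2 \<Rightarrow> l2 \<Rightarrow> real" is "\<lambda>f g. \<integral>x. f x \<bullet> g x \<partial>halfline"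
proof -
  fix f f' g g' assume *: "l2_eq f f'" "l2_eq g g'"
  then have [measurable]: "f \<in> borel_measurable halfline" "f' \<in> borel_measurable halfline"
    "g \<in> borel_measurable halfline" "g' \<in> borel_measurable halfline"
    by (auto simp: l2_eq_def square_integrable_def)
  show "(\<integral>x. f x \<bullet> g x \<partial>halfline) = (\<integral>x. f' x \<bullet> g' x \<partial>halfline)"
    by (rule integral_cong_AE) (use * in \<open>auto simp: l2_eq_def\<close>)
qed

definition norm_l2 :: "l2 \<Rightarrow> real" where "norm_l2 f = sqrt (f \<bullet> f)"
definition dist_l2 :: "l2 \<Rightarrow> l2 \<Rightarrow> real" where "dist_l2 f g = norm (f - g)"
definition sgn_l2 :: "l2 \<Rightarrow> l2" where "sgn_l2 f = inverse (norm f) *\<^sub>R f"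
definition uniformity_l2 :: "(l2 \<times> l2) filter"
  where "uniformity_l2 = (INF e\<in>{0<..}. principal {(f, g). dist f g < e})"
definition open_l2 :: "l2 set \<Rightarrow> bool"
  where "open_l2 U = (\<forall>f\<in>U. \<forall>\<^sub>F (f', g) in uniformity. f' = f \<longrightarrow> g \<in> U)"

instance
proof
  fix f g h :: l2 and a b :: real
  show "f + g + h = f + (g + h)"
    by transfer (auto simp: l2_eq_def add.assoc square_integrable_add)
  show "f + g = g + f"
    by transfer (auto simp: l2_eq_def add.commute square_integrable_add)
  show "0 + f = f"
    by transfer (auto simp: l2_eq_def)
  show "- f + f = 0"
    by transfer (auto simp: l2_eq_def square_integrable_zero)
  show "f - g = f + - g"
    by transfer (auto simp: l2_eq_def square_integrable_diff)
  show "a *\<^sub>R (f + g) = a *\<^sub>R f + a *\<^sub>R g"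
    by transfer
      (auto simp: l2_eq_def distrib_left intro!: square_integrable_add square_integrable_cmult)
  show "(a + b) *\<^sub>R f = a *\<^sub>R f + b *\<^sub>R f"
    by transfer
      (auto simp: l2_eq_def distrib_right intro!: square_integrable_add square_integrable_cmult)
  show "a *\<^sub>R b *\<^sub>R f = (a * b) *\<^sub>R f"
    by transfer (use square_integrable_cmult in \<open>auto simp: l2_eq_def mult.assoc\<close>)
  show "1 *\<^sub>R f = f"
    by transfer (auto simp: l2_eq_def)
  show "dist f g = norm (f - g)" by (rule dist_l2_def)
  show "sgn f = inverse (norm f) *\<^sub>R f" by (rule sgn_l2_def)
  show "uniformity = (INF e\<in>{0<..}. principal {(f, g :: l2). dist f g < e})"
    by (rule uniformity_l2_def)
  show "open U = (\<forall>f\<in>U. \<forall>\<^sub>F (f', g) in uniformity. f' = f \<longrightarrow> g \<in> U)" for U :: "l2 set"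
    by (rule open_l2_def)
  show "f \<bullet> g = g \<bullet> f"
    by transfer (simp add: inner_commute)
  show "(f + g) \<bullet> h = f \<bullet> h + g \<bullet> h"
    by transfer (simp add: inner_add_left l2_eq_def square_integrable_inner)
  show "(a *\<^sub>R f) \<bullet> g = a * (f \<bullet> g)"
  proof transfer
    fix r and u v :: "real \<Rightarrow> complex"
    have "(complex_of_real r * u x) \<bullet> v x = r * (u x \<bullet> v x)" for x
      by (simp flip: scaleR_conv_of_real)
    then show "(\<integral>x. (complex_of_real r * u x) \<bullet> v x \<partial>halfline)
      = r * (\<integral>x. u x \<bullet> v x \<partial>halfline)" by simp
  qed
  show "0 \<le> f \<bullet> f"
    by transfer simp
  show "f \<bullet> f = 0 \<longleftrightarrow> f = 0"
  proof transfer
    fix u assume "l2_eq u u"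
    then have u: "square_integrable u" by (simp add: l2_eq_def)
    have "(\<integral>x. u x \<bullet> u x \<partial>halfline) = 0 \<longleftrightarrow> (AE x in halfline. u x \<bullet> u x = 0)"
      by (rule integral_nonneg_eq_0_iff_AE) (auto intro: square_integrable_inner u)
    then show "(\<integral>x. u x \<bullet> u x \<partial>halfline) = 0 \<longleftrightarrow> l2_eq u (\<lambda>x. 0)"
      by (simp add: l2_eq_def u square_integrable_zero)
  qed
  show "norm f = sqrt (f \<bullet> f)" by (rule norm_l2_def)
qed

end

lift_definition scaleC_l2 :: "complex \<Rightarrow> l2 \<Rightarrow> l2" is "\<lambda>c f x. c * f x"
  by (auto simp: l2_eq_def square_integrable_cmult)

lemma norm_l2: "norm f = sqrt (\<integral>x. (cmod (rep_l2 f x))\<^sup>2 \<partial>halfline)"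
  by (simp add: norm_l2_def inner_l2.rep_eq power2_norm_eq_inner)

text \<open>\<open>L\<^sup>2 \<oplus> L\<^sup>2\<close> is the product type, whose library norm is the Hilbert space norm
  \<open>sqrt (\<parallel>f\<^sub>1\<parallel>\<^sup>2 + \<parallel>f\<^sub>2\<parallel>\<^sup>2)\<close>.\<close>

type_synonym l2x2 = "l2 \<times> l2"

definition scaleC_l2x2 :: "complex \<Rightarrow> l2x2 \<Rightarrow> l2x2"
  where "scaleC_l2x2 c f = (scaleC_l2 c (fst f), scaleC_l2 c (snd f))"


section \<open>Semigroups\<close>

text \<open>Only the values \<open>T t\<close> with \<open>t \<ge> 0\<close> are relevant. A C0-semigroup consists of complex-linear
  bounded operators; \<^const>\<open>bounded_linear\<close> only yields real-linearity.\<close>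

definition C0_semigroup :: "(real \<Rightarrow> l2x2 \<Rightarrow> l2x2) \<Rightarrow> bool"
  where "C0_semigroup T \<longleftrightarrow>
    (\<forall>t\<ge>0. bounded_linear (T t) \<and> (\<forall>c f. T t (scaleC_l2x2 c f) = scaleC_l2x2 c (T t f))) \<and>
    (\<forall>f. T 0 f = f) \<and>
    (\<forall>s\<ge>0. \<forall>t\<ge>0. \<forall>f. T (s + t) f = T s (T t f)) \<and>
    (\<forall>f. ((\<lambda>t. T t f) \<longlongrightarrow> f) (at_right 0))"

definition contractive :: "(real \<Rightarrow> l2x2 \<Rightarrow> l2x2) \<Rightarrow> bool"
  where "contractive T \<longleftrightarrow> (\<forall>t\<ge>0. \<forall>f. norm (T t f) \<le> norm f)"

text \<open>Unbounded operators are identified with their graphs.\<close>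

definition generator :: "(real \<Rightarrow> l2x2 \<Rightarrow> l2x2) \<Rightarrow> (l2x2 \<times> l2x2) set"
  where "generator T = {(f, g). ((\<lambda>t. (T t f - f) /\<^sub>R t) \<longlongrightarrow> g) (at_right 0)}"


section \<open>The operator \<open>\<Delta>(A,B)\<close>\<close>

definition test_function :: "(real \<Rightarrow> real) \<Rightarrow> bool"
  where "test_function \<phi> \<longleftrightarrow>
    (\<forall>n x. (deriv ^^ n) \<phi> field_differentiable at x) \<and>
    (\<exists>a b. 0 < a \<and> (\<forall>x. x \<notin> {a..b} \<longrightarrow> \<phi> x = 0))"

text \<open>\<open>g \<in> L\<^sup>2\<close> is the weak derivative of \<open>f \<in> L\<^sup>2\<close> on \<open>(0,\<infinity>)\<close>.\<close>

definition has_weak_deriv :: "l2 \<Rightarrow> l2 \<Rightarrow> bool"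
  where "has_weak_deriv f g \<longleftrightarrow> (\<forall>\<phi>. test_function \<phi> \<longrightarrow>
    (\<integral>x. rep_l2 f x * of_real (deriv \<phi> x) \<partial>halfline) =
    - (\<integral>x. rep_l2 g x * of_real (\<phi> x) \<partial>halfline))"

text \<open>The value at 0 of the continuous representative on \<open>[0,\<infinity>)\<close>, which every function with a
  weak derivative in \<open>L\<^sup>2\<close> has; such a representative is unique.\<close>

definition has_trace :: "l2 \<Rightarrow> complex \<Rightarrow> bool"
  where "has_trace f c \<longleftrightarrow>
    (\<exists>u. continuous_on {0..} u \<and> (AE x in halfline. rep_l2 f x = u x) \<and> u 0 = c)"

text \<open>Membership of \<open>\<psi>\<^sub>j\<close> in \<open>H\<^sup>2\<close> is the existence of the weak derivatives
  \<open>\<psi>\<^sub>j'\<close> and \<open>\<psi>\<^sub>j''\<close> in \<open>L\<^sup>2\<close>.\<close>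

definition Delta :: "complex^2^2 \<Rightarrow> complex^2^2 \<Rightarrow> (l2x2 \<times> l2x2) set"
  where "Delta A B =
    {((\<psi>1, \<psi>2), (\<psi>1'', \<psi>2'')) | \<psi>1 \<psi>2 \<psi>1'' \<psi>2''. \<exists>\<psi>1' \<psi>2' a1 a2 b1 b2.
      has_weak_deriv \<psi>1 \<psi>1' \<and> has_weak_deriv \<psi>1' \<psi>1'' \<and>
      has_weak_deriv \<psi>2 \<psi>2' \<and> has_weak_deriv \<psi>2' \<psi>2'' \<and>
      has_trace \<psi>1 a1 \<and> has_trace \<psi>2 a2 \<and> has_trace \<psi>1' b1 \<and> has_trace \<psi>2' b2 \<and>
      A *v vector [a1, a2] + B *v vector [b1, b2] = 0}"

definition block_row :: "complex^2^2 \<Rightarrow> complex^2^2 \<Rightarrow> complex^(2 + 2)^2"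
  where "block_row A B = (\<chi> i j. case j of Inl k \<Rightarrow> A $ i $ k | Inr k \<Rightarrow> B $ i $ k)"

definition scale_matrix :: "complex \<Rightarrow> complex^2^2 \<Rightarrow> complex^2^2"
  where "scale_matrix c M = map_matrix ((*) c) M"

definition regular :: "complex^2^2 \<Rightarrow> complex^2^2 \<Rightarrow> bool"
  where "regular A B \<longleftrightarrow>
    rank (block_row A B) = 2 \<and> (\<exists>k. invertible (A + scale_matrix (\<i> * k) B))"

text \<open>Meaningful only if \<open>A + \<i>kB\<close> is invertible. For \<open>k = \<i>\<kappa>\<close> with \<open>\<kappa> > 0\<close> this is automatic if
  \<open>\<Delta>(A,B)\<close> generates a contractive semigroup: a nonzero \<open>a\<close> with \<open>(A - \<kappa>B)a = 0\<close> would give the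
  eigenfunction \<open>exp (- \<kappa>x) a\<close> with eigenvalue \<open>\<kappa>\<^sup>2 > 0\<close>.\<close>

definition cayley :: "complex \<Rightarrow> complex^2^2 \<Rightarrow> complex^2^2 \<Rightarrow> complex^2^2"
  where "cayley k A B =
    - (matrix_inv (A + scale_matrix (\<i> * k) B) ** (A - scale_matrix (\<i> * k) B))"

definition kernel_matrix ::
    "real \<Rightarrow> real \<Rightarrow> real \<Rightarrow> real \<Rightarrow> real \<Rightarrow> complex^2^2 \<Rightarrow> complex^2^2 \<Rightarrow> complex^2^2"
  where "kernel_matrix \<kappa> x1 x2 y1 y2 A B =
    (let S = cayley (\<i> * of_real \<kappa>) A B in
     scale_matrix (of_real (\<kappa> / 2)) (vector
      [vector [of_real (exp (- \<kappa> * \<bar>x1 - y1\<bar>)) + of_real (exp (- \<kappa> * (x1 + y1))) * S $ 1 $ 1,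
               of_real (exp (- \<kappa> * (x1 + y2))) * S $ 1 $ 2],
       vector [of_real (exp (- \<kappa> * (x2 + y1))) * S $ 2 $ 1,
               of_real (exp (- \<kappa> * \<bar>x2 - y2\<bar>)) + of_real (exp (- \<kappa> * (x2 + y2))) * S $ 2 $ 2]]))"


section \<open>Invariance and \<open>L\<^sup>\<infinity>\<close>-contractivity\<close>

definition leaves_invariant :: "('a \<Rightarrow> 'a) \<Rightarrow> 'a set \<Rightarrow> bool"
  where "leaves_invariant T K \<longleftrightarrow> T ` K \<subseteq> K"

definition induced_set :: "(complex^2) set \<Rightarrow> l2x2 set"
  where "induced_set C = {f. AE x in halfline. vector [rep_l2 (fst f) x, rep_l2 (snd f) x] \<in> C}"

text \<open>\<open>L\<^sup>\<infinity> \<oplus> L\<^sup>\<infinity>\<close> carries the sup norm of the disjoint union of the two half-lines, i.e. the maximum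
  of the two essential suprema; its value is \<open>\<infinity>\<close> outside of \<open>L\<^sup>\<infinity> \<oplus> L\<^sup>\<infinity>\<close>.\<close>

definition Linf_norm :: "l2x2 \<Rightarrow> ennreal"
  where "Linf_norm f =
    max (esssup halfline (\<lambda>x. ennreal (cmod (rep_l2 (fst f) x))))
        (esssup halfline (\<lambda>x. ennreal (cmod (rep_l2 (snd f) x))))"

definition Linf_contractive :: "(real \<Rightarrow> l2x2 \<Rightarrow> l2x2) \<Rightarrow> bool"
  where "Linf_contractive T \<longleftrightarrow>
    (\<forall>t\<ge>0. \<forall>f. Linf_norm f < \<infinity> \<longrightarrow> Linf_norm (T t f) \<le> Linf_norm f)"

end

theory Submission
  imports Defs
begin

text \<open>Write \<open>S = \<SS>(i\<kappa>; A, B)\<close>. For every \<open>\<kappa> > 0\<close> the operator \<open>\<kappa>\<^sup>2 (\<kappa>\<^sup>2 - \<Delta>(A,B))\<inverse>\<close> is an integral operator: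
  it maps \<open>f\<close> to \<open>u(x) = \<integral> K(x,y) f(y) dy\<close>, where \<open>K(x,y)\<close> is the matrix of the theorem for
  \<open>x\<^sub>1 = x\<^sub>2 = x\<close> and \<open>y\<^sub>1 = y\<^sub>2 = y\<close>. The part with \<open>exp (-\<kappa>|x - y|)\<close> solves \<open>\<kappa>\<^sup>2 u - u'' = \<kappa>\<^sup>2 f\<close> on the
  whole line, for \<open>f\<close> extended by 0, and the multiple of \<open>exp (-\<kappa>x)\<close> that \<open>S\<close> adds to it is the one
  for which \<open>u\<close> satisfies the boundary condition (\<open>resolvent_fun_in_Delta\<close>). Both assertions are thus read off from averages
  of the values of \<open>f\<close>, first for the resolvent and then, by the exponential formula
  \<open>T(t) = lim (1 - (t/n) \<Delta>(A,B))\<^sup>-\<^sup>n\<close>, for the semigroup, because the induced set of a closed set is closed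
  in \<open>L\<^sup>2\<close> (\<open>semigroup_invariant_induced_set\<close>).

  The total mass of \<open>K(x,y) dy\<close> is in general not the identity, so convexity of \<open>C\<close> alone does not
  put the average into \<open>C\<close>. But the hypothesis ranges over all points: as \<open>x = y\<close> tends to infinity,
  the matrix tends to \<open>\<kappa>/2\<close> times the identity, hence \<open>C\<close> is invariant under all positive multiples
  (\<open>scaleR_mem_if_kernel_invariant\<close>). A closed convex cone contains the integral of every function with
  values in it, whatever the mass of the measure (\<open>integral_mem_closed_convex_cone\<close>).

  For \<open>L\<^sup>\<infinity>\<close>-contractivity, write the kernel as
  \<open>\<kappa>/2 ((exp (-\<kappa>|x - y|) - exp (-\<kappa>(x + y))) I + exp (-\<kappa>(x + y)) (I + S))\<close>. The first weight is
  nonnegative, and the hypothesis bounds the columns of \<open>I + S\<close>; in particular each of its entries has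
  modulus at most 1, so that each of its rows has \<open>\<ell>\<^sup>1\<close>-norm at most 2. Therefore \<open>|u\<^sub>i(x)|\<close> is at most
  \<open>\<parallel>f\<parallel>\<^sub>\<infinity>\<close> times \<open>\<kappa>/2 \<integral> (exp (-\<kappa>|x - y|) + exp (-\<kappa>(x + y))) dy = 1\<close> (\<open>norm_resolvent_fun_le\<close>). This is
  the invariance of the set of all \<open>\<xi>\<close> with \<open>|\<xi>\<^sub>1|, |\<xi>\<^sub>2| \<le> c\<close> under the resolvent.\<close>

section \<open>Contraction semigroups and their resolvents\<close>

locale contraction_semigroup =
  fixes T :: "real \<Rightarrow> 'a \<Rightarrow> 'a::real_normed_vector"
  assumes bounded_linear: "0 \<le> t \<Longrightarrow> bounded_linear (T t)"
    and T_0 [simp]: "T 0 f = f"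
    and T_add: "0 \<le> s \<Longrightarrow> 0 \<le> t \<Longrightarrow> T (s + t) f = T s (T t f)"
    and tendsto_at_0: "((\<lambda>t. T t f) \<longlongrightarrow> f) (at_right 0)"
    and norm_le: "0 \<le> t \<Longrightarrow> norm (T t f) \<le> norm f"
begin

definition gen :: "'a \<Rightarrow> 'a \<Rightarrow> bool"
  where "gen u g \<longleftrightarrow> ((\<lambda>t. (T t u - u) /\<^sub>R t) \<longlongrightarrow> g) (at_right 0)"

lemma T_diff: "0 \<le> t \<Longrightarrow> T t (f - g) = T t f - T t g"
  by (simp add: bounded_linear linear_diff bounded_linear.linear)

lemma T_scaleR: "0 \<le> t \<Longrightarrow> T t (c *\<^sub>R f) = c *\<^sub>R T t f"
  by (simp add: bounded_linear linear_scale bounded_linear.linear)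

lemma eventually_pos: "\<forall>\<^sub>F t :: real in at_right 0. 0 < t"
  by (simp add: eventually_at_right_less)

lemma gen_diff:
  assumes "gen u g" "gen v k"
  shows "gen (u - v) (g - k)"
proof -
  have "((\<lambda>t. (T t u - u) /\<^sub>R t - (T t v - v) /\<^sub>R t) \<longlongrightarrow> g - k) (at_right 0)"
    using assms unfolding gen_def by (rule tendsto_diff)
  then show ?thesis unfolding gen_def
    by (rule Lim_transform_eventually)
      (use eventually_pos in eventually_elim, simp add: T_diff algebra_simps)
qed

lemma gen_scaleR:
  assumes "gen u g"
  shows "gen (c *\<^sub>R u) (c *\<^sub>R g)"
proof -
  have "((\<lambda>t. c *\<^sub>R ((T t u - u) /\<^sub>R t)) \<longlongrightarrow> c *\<^sub>R g) (at_right 0)"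
    using assms unfolding gen_def by (intro tendsto_intros)
  then show ?thesis unfolding gen_def
    by (rule Lim_transform_eventually)
      (use eventually_pos in eventually_elim, simp add: T_scaleR algebra_simps)
qed

lemma gen_T:
  assumes "gen u g" and s: "0 \<le> s"
  shows "gen (T s u) (T s g)"
proof -
  have "((\<lambda>t. T s ((T t u - u) /\<^sub>R t)) \<longlongrightarrow> T s g) (at_right 0)"
    using assms unfolding gen_def by (intro bounded_linear.tendsto[OF bounded_linear])
  then show ?thesis unfolding gen_def
    by (rule Lim_transform_eventually)
      (use eventually_pos in eventually_elim,
        simp add: s T_diff T_scaleR add.commute[of s] flip: T_add)
qed

text \<open>The inequality holds with the difference quotient in place of \<open>g\<close>, by contractivity; pass to the
  limit.\<close>

lemma dissipative:
  assumes "gen u g" and h: "0 < h"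
  shows "norm u \<le> norm (u - h *\<^sub>R g)"
proof (rule tendsto_lowerbound)
  show "((\<lambda>t. norm (u - h *\<^sub>R ((T t u - u) /\<^sub>R t))) \<longlongrightarrow> norm (u - h *\<^sub>R g)) (at_right 0)"
    using assms unfolding gen_def by (intro tendsto_intros)
  show "\<forall>\<^sub>F t in at_right 0. norm u \<le> norm (u - h *\<^sub>R ((T t u - u) /\<^sub>R t))"
    using eventually_pos
  proof eventually_elim
    fix t :: real assume t: "0 < t"
    have "u - h *\<^sub>R ((T t u - u) /\<^sub>R t) = (1 + h / t) *\<^sub>R u - (h / t) *\<^sub>R T t u"
      by (simp add: algebra_simps divide_inverse)
    moreover have "norm ((1 + h / t) *\<^sub>R u - (h / t) *\<^sub>R T t u) \<ge> (1 + h / t) * norm u - (h / t) * norm (T t u)"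
      using norm_triangle_ineq2[of "(1 + h / t) *\<^sub>R u" "(h / t) *\<^sub>R T t u"] t h by simp
    moreover have "(h / t) * norm (T t u) \<le> (h / t) * norm u"
      using t h norm_le[of t u] by (intro mult_left_mono) auto
    ultimately show "norm u \<le> norm (u - h *\<^sub>R ((T t u - u) /\<^sub>R t))"
      by (simp only: distrib_right)
  qed
qed simp

lemma norm_T_diff_le:
  assumes "0 \<le> s" "0 \<le> t"
  shows "norm (T s f - T t f) \<le> norm (T \<bar>s - t\<bar> f - f)"
proof -
  have *: "norm (T (r + d) f - T r f) \<le> norm (T d f - f)" if "0 \<le> r" "0 \<le> d" for r d
    using that norm_le[of r "T d f - f"] by (simp add: T_add T_diff)
  show ?thesis
    using *[of t "s - t"] *[of s "t - s"] assms
    by (cases "t \<le> s") (auto simp: norm_minus_commute abs_if)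
qed

lemma continuous_on_T: "continuous_on {0..} (\<lambda>t. T t f)"
  unfolding continuous_on_iff
proof (intro ballI allI impI)
  fix t e :: real assume t: "t \<in> {0..}" and "0 < e"
  then have "\<forall>\<^sub>F h in at_right 0. dist (T h f) f < e"
    using tendstoD[OF tendsto_at_0] by blast
  then obtain d where d: "0 < d" "\<And>h. 0 < h \<Longrightarrow> h < d \<Longrightarrow> dist (T h f) f < e"
    unfolding eventually_at_right_field by auto
  have "dist (T s f) (T t f) < e" if "s \<in> {0..}" "dist s t < d" for s
  proof (cases "s = t")
    case False
    have "dist (T s f) (T t f) \<le> norm (T \<bar>s - t\<bar> f - f)"
      using that t norm_T_diff_le[of s t f] by (simp add: dist_norm)
    also have "\<dots> < e"
      using d(2)[of "\<bar>s - t\<bar>"] that False by (simp add: dist_norm)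
    finally show ?thesis .
  qed (use \<open>0 < e\<close> in simp)
  then show "\<exists>d>0. \<forall>s\<in>{0..}. dist s t < d \<longrightarrow> dist (T s f) (T t f) < e"
    using d(1) by blast
qed

text \<open>Only the right derivative at 0 is given. Since the operators are contractions, the error of the
  difference quotient at \<open>t\<close> is controlled from either side by the error at 0 plus \<open>\<parallel>T h g - g\<parallel>\<close>.\<close>

lemma has_vector_derivative_T:
  assumes g: "gen u g" and t: "0 < t"
  shows "((\<lambda>s. T s u) has_vector_derivative T t g) (at t)"
proof -
  define r where "r h = norm ((T h u - u) /\<^sub>R h - g) + norm (T h g - g)" for h
  have r: "(r \<longlongrightarrow> 0) (at_right 0)"
    unfolding r_def using Lim_null[THEN iffD1, OF g[unfolded gen_def]]
      Lim_null[THEN iffD1, OF tendsto_at_0]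
    by (intro tendsto_add_zero tendsto_norm_zero)
  have fwd: "norm ((T (a + h) u - T a u) /\<^sub>R h - T b g) \<le> r h"
    if "0 \<le> a" "0 < h" "b = a \<or> b = a + h" for a b h
  proof -
    have "(T (a + h) u - T a u) /\<^sub>R h - T b g
      = T a ((T h u - u) /\<^sub>R h - g) + (T a g - T b g)"
      using that by (simp add: T_add T_diff T_scaleR)
    also have "norm \<dots> \<le> norm (T a ((T h u - u) /\<^sub>R h - g)) + norm (T a g - T b g)"
      by (rule norm_triangle_ineq)
    also have "\<dots> \<le> norm ((T h u - u) /\<^sub>R h - g) + norm (T h g - g)"
      using norm_le[of a] norm_T_diff_le[of a b g] that by (intro add_mono) auto
    finally show ?thesis by (simp add: r_def)
  qed
  have "((\<lambda>s. (T s u - T t u) /\<^sub>R (s - t)) \<longlongrightarrow> T t g) (at t)"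
  proof (rule tendsto_norm_zero_cancel[THEN Lim_null[THEN iffD2]], rule tendsto_sandwich[OF _ _ tendsto_const])
    show "((\<lambda>s. r \<bar>s - t\<bar>) \<longlongrightarrow> 0) (at t)"
      by (rule filterlim_compose[OF r])
        (auto simp: filterlim_at eventually_at_filter intro!: tendsto_eq_intros)
    show "\<forall>\<^sub>F s in at t. norm ((T s u - T t u) /\<^sub>R (s - t) - T t g) \<le> r \<bar>s - t\<bar>"
      unfolding eventually_at_topological
    proof -
      have "norm ((T s u - T t u) /\<^sub>R (s - t) - T t g) \<le> r \<bar>s - t\<bar>" if "0 < s" "s \<noteq> t" for s
      proof (cases "t < s")
        case True
        then show ?thesis using fwd[of t "s - t" t] t by simp
      next
        case False
        have "(T s u - T t u) /\<^sub>R (s - t) = (T t u - T s u) /\<^sub>R (t - s)"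
          using False that by (metis (no_types, lifting) inverse_minus_eq minus_diff_eq scaleR_minus_left scaleR_minus_right)
        then show ?thesis using fwd[of s "t - s" t] that False by simp
      qed
      moreover have "open {0 :: real<..}" "t \<in> {0<..}" using t by auto
      ultimately show "\<exists>S. open S \<and> t \<in> S \<and> (\<forall>s\<in>S. s \<noteq> t \<longrightarrow> s \<in> UNIV \<longrightarrow>
        norm ((T s u - T t u) /\<^sub>R (s - t) - T t g) \<le> r \<bar>s - t\<bar>)"
        by blast
    qed
  qed (auto intro: always_eventually)
  then have "((\<lambda>s. norm ((T s u - T t u) /\<^sub>R (s - t) - T t g)) \<longlongrightarrow> 0) (at t)"
    by (intro tendsto_norm_zero LIM_zero)
  moreover have "\<forall>\<^sub>F s in at t. norm ((T s u - T t u) /\<^sub>R (s - t) - T t g)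
    = norm (T s u - T t u - (s - t) *\<^sub>R T t g) / norm (s - t)"
  proof -
    have "norm ((T s u - T t u) /\<^sub>R (s - t) - T t g)
      = norm (T s u - T t u - (s - t) *\<^sub>R T t g) / norm (s - t)" if "s \<noteq> t" for s
    proof -
      have "T s u - T t u - (s - t) *\<^sub>R T t g
        = (s - t) *\<^sub>R ((T s u - T t u) /\<^sub>R (s - t) - T t g)"
        using that by (simp add: scaleR_diff_right)
      then show ?thesis using that by simp
    qed
    then show ?thesis by (simp add: eventually_at_filter)
  qed
  ultimately show ?thesis
    unfolding has_vector_derivative_def has_derivative_iff_norm
    by (simp add: bounded_linear_scaleR_left Lim_transform_eventually)
qed

end

text \<open>The equation \<open>u - h g = f\<close>, where \<open>g\<close> is the value of the generator at \<open>u\<close>, is written as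
  \<open>g = (u - f) / h\<close>. Its solution, unique by dissipativity, is \<open>J h f = (1 - hG)\<inverse> f\<close>.\<close>

locale contraction_semigroup_resolvent = contraction_semigroup T
  for T :: "real \<Rightarrow> 'a \<Rightarrow> 'a::real_normed_vector" +
  assumes ex_resolvent: "0 < h \<Longrightarrow> \<exists>u. gen u ((u - f) /\<^sub>R h)"
begin

definition J :: "real \<Rightarrow> 'a \<Rightarrow> 'a"
  where "J h f = (SOME u. gen u ((u - f) /\<^sub>R h))"

lemma gen_J: "0 < h \<Longrightarrow> gen (J h f) ((J h f - f) /\<^sub>R h)"
  unfolding J_def by (rule someI_ex) (rule ex_resolvent)

lemma norm_diff_le_resolvent:
  assumes "gen u ((u - f) /\<^sub>R h)" "gen v ((v - g) /\<^sub>R h)" "0 < h"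
  shows "norm (u - v) \<le> norm (f - g)"
proof -
  have "norm (u - v) \<le> norm (u - v - h *\<^sub>R ((u - f) /\<^sub>R h - (v - g) /\<^sub>R h))"
    by (rule dissipative[OF gen_diff[OF assms(1,2)] assms(3)])
  also have "u - v - h *\<^sub>R ((u - f) /\<^sub>R h - (v - g) /\<^sub>R h) = f - g"
    using assms(3) by (simp add: scaleR_diff_right)
  finally show ?thesis .
qed

lemma norm_J_diff_le: "0 < h \<Longrightarrow> norm (J h f - J h g) \<le> norm (f - g)"
  by (rule norm_diff_le_resolvent[OF gen_J gen_J])

lemma J_eqI: "0 < h \<Longrightarrow> gen u ((u - f) /\<^sub>R h) \<Longrightarrow> J h f = u"
  using norm_diff_le_resolvent[OF gen_J, of h u f f] by simp

lemma J_T: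
  assumes "0 < h" "0 \<le> s"
  shows "J h (T s f) = T s (J h f)"
  using gen_T[OF gen_J[OF assms(1)] assms(2), of f] assms
  by (intro J_eqI) (simp_all add: T_scaleR T_diff)

lemma J_minus_id:
  assumes f: "gen f g" and h: "0 < h"
  shows "J h f - f = h *\<^sub>R J h g"
proof -
  have "gen (f - (- h) *\<^sub>R J h g) (g - (- h) *\<^sub>R ((J h g - g) /\<^sub>R h))"
    by (intro gen_diff gen_scaleR f gen_J h)
  then have "J h f = f - (- h) *\<^sub>R J h g"
    using h by (intro J_eqI) (simp_all add: scaleR_diff_right)
  then show ?thesis by simp
qed

text \<open>In a Banach space, \<open>J h f\<close> is the average \<open>\<integral> exp (-s) T (h s) f ds\<close> over \<open>s > 0\<close>, so that it is
  close to \<open>f\<close> if \<open>T (h s) f\<close> is close to \<open>f\<close> for all \<open>s\<close> outside of a tail of small mass. The same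
  estimate comes out of the mean value inequality, which needs no vector-valued integral, applied to
  \<open>w s = exp (-s) (T (h s) u - f)\<close> with \<open>u = J h f\<close>: its derivative is \<open>exp (-s) (f - T (h s) f)\<close>, and
  \<open>w 0 = J h f - f\<close>.\<close>

lemma norm_J_minus_id_le:
  assumes h: "0 < h" and S: "0 < S" and e: "\<And>t. 0 \<le> t \<Longrightarrow> t \<le> h * S \<Longrightarrow> norm (T t f - f) \<le> e"
  shows "norm (J h f - f) \<le> e + 2 * exp (- S) * norm f"
proof -
  define u where "u = J h f"
  define w where "w s = exp (- s) *\<^sub>R (T (h * s) u - f)" for s
  have u: "norm u \<le> norm f"
  proof -
    have "J h 0 = 0"
      using gen_scaleR[OF gen_J[OF h], of 0 0] h by (intro J_eqI) auto
    then show ?thesis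
      using norm_J_diff_le[OF h, of f 0] by (simp add: u_def)
  qed
  have g: "gen u ((u - f) /\<^sub>R h)" unfolding u_def by (rule gen_J[OF h])
  have "norm (w S - w 0) \<le> (- e * exp (- S)) - (- e * exp (- 0))"
  proof (rule differentiable_bound_general[OF S])
    show "continuous_on {0..S} w"
      unfolding w_def using h
      by (intro continuous_intros continuous_on_compose2[OF continuous_on_T]) auto
    fix s assume s: "0 < s" "s < S"
    have "((\<lambda>s. T (h * s) u) has_vector_derivative h *\<^sub>R T (h * s) ((u - f) /\<^sub>R h)) (at s)"
      using has_vector_derivative_T[OF g, of "h * s"] s h
      by (intro vector_diff_chain_at[of "\<lambda>s. h * s" h s "\<lambda>t. T t u", unfolded o_def])
        (auto intro!: derivative_eq_intros simp: has_vector_derivative_def)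
    then have "(w has_vector_derivative exp (- s) *\<^sub>R (h *\<^sub>R T (h * s) ((u - f) /\<^sub>R h))
        + (- exp (- s)) *\<^sub>R (T (h * s) u - f)) (at s)"
      unfolding w_def by (auto intro!: derivative_eq_intros)
    moreover have "exp (- s) *\<^sub>R (h *\<^sub>R T (h * s) ((u - f) /\<^sub>R h))
        + (- exp (- s)) *\<^sub>R (T (h * s) u - f) = exp (- s) *\<^sub>R (f - T (h * s) f)"
      using h s by (simp add: T_scaleR T_diff algebra_simps)
    ultimately show "(w has_vector_derivative exp (- s) *\<^sub>R (f - T (h * s) f)) (at s)"
      by simp
    show "norm (exp (- s) *\<^sub>R (f - T (h * s) f)) \<le> e * exp (- s)"
      using e[of "h * s"] s h by (simp add: norm_minus_commute)
    show "((\<lambda>s. - e * exp (- s)) has_vector_derivative e * exp (- s)) (at s)"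
      unfolding has_real_derivative_iff_has_vector_derivative[symmetric]
      by (auto intro!: derivative_eq_intros)
  qed (intro continuous_intros)
  moreover have "norm (w S) \<le> exp (- S) * (2 * norm f)"
  proof -
    have "norm (T (h * S) u - f) \<le> 2 * norm f"
      using norm_triangle_ineq4[of "T (h * S) u" f] norm_le[of "h * S" u] h S u by simp
    then show ?thesis by (simp add: w_def)
  qed
  moreover have "norm (w 0) \<le> norm (w S) + norm (w S - w 0)"
    by (metis add.commute norm_minus_commute norm_triangle_sub)
  moreover have "w 0 = J h f - f" by (simp add: w_def u_def)
  moreover have "0 \<le> e * exp (- S)" using e[of 0] h S by simp
  ultimately show ?thesis by simp
qed

lemma J_tendsto: "((\<lambda>h. J h f) \<longlongrightarrow> f) (at_right 0)"
proof (rule tendstoI)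
  fix e :: real assume e: "0 < e"
  have "((\<lambda>S. 2 * exp (- S) * norm f) \<longlongrightarrow> 2 * 0 * norm f) at_top"
    by (intro tendsto_intros filterlim_compose[OF exp_at_bot] filterlim_uminus_at_bot_at_top)
  then have "\<forall>\<^sub>F S in at_top. 2 * exp (- S) * norm f < e / 2"
    by (rule order_tendstoD) (use e in simp)
  then have "\<forall>\<^sub>F S in at_top. 0 < S \<and> 2 * exp (- S) * norm f < e / 2"
    using eventually_gt_at_top[of 0] by eventually_elim simp
  then obtain S where S: "0 < S" "2 * exp (- S) * norm f < e / 2"
    by (auto dest: eventually_happens)
  have "\<forall>\<^sub>F t in at_right 0. dist (T t f) f < e / 2"
    using e tendsto_at_0 by (intro tendstoD) auto
  then obtain d where d: "0 < d" "\<And>t. 0 < t \<Longrightarrow> t < d \<Longrightarrow> dist (T t f) f < e / 2"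
    unfolding eventually_at_right_field by auto
  have "dist (J h f) f < e" if h: "0 < h" "h < d / S" for h
  proof -
    have "norm (J h f - f) \<le> e / 2 + 2 * exp (- S) * norm f"
    proof (rule norm_J_minus_id_le[OF h(1) S(1)])
      fix t :: real assume t: "0 \<le> t" "t \<le> h * S"
      have "h * S < d" using h(2) S(1) by (simp add: pos_less_divide_eq)
      then show "norm (T t f - f) \<le> e / 2"
        using d(2)[of t] t e by (cases "t = 0") (auto simp: dist_norm)
    qed
    then show ?thesis using S(2) by (simp add: dist_norm)
  qed
  then show "\<forall>\<^sub>F h in at_right 0. dist (J h f) f < e"
    unfolding eventually_at_right_field using d(1) S(1) by (intro exI[of _ "d / S"]) auto
qed

text \<open>Telescoping: \<open>T h\<close> and \<open>J h\<close> are commuting contractions, so that each of the \<open>n\<close> replacements of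
  \<open>T h\<close> by \<open>J h\<close> costs at most \<open>\<parallel>T h f - J h f\<parallel>\<close>.\<close>

lemma norm_T_funpow_minus_J_funpow_le:
  assumes h: "0 < h"
  shows "norm (T (real n * h) f - (J h ^^ n) f) \<le> real n * norm (T h f - J h f)"
proof (induction n)
  case (Suc n)
  have "T (real (Suc n) * h) f - (J h ^^ Suc n) f
    = T (real n * h) (T h f - J h f) + (J h (T (real n * h) f) - J h ((J h ^^ n) f))"
    using h by (simp add: J_T T_diff distrib_right add.commute flip: T_add)
  also have "norm \<dots> \<le> norm (T (real n * h) (T h f - J h f))
    + norm (J h (T (real n * h) f) - J h ((J h ^^ n) f))"
    by (rule norm_triangle_ineq)
  also have "\<dots> \<le> norm (T h f - J h f) + norm (T (real n * h) f - (J h ^^ n) f)"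
    using h by (intro add_mono norm_le norm_J_diff_le) auto
  also have "\<dots> \<le> real (Suc n) * norm (T h f - J h f)"
    using Suc.IH by (simp add: distrib_right)
  finally show ?case .
qed simp

text \<open>The exponential formula on the domain of the generator. There \<open>T h f - f\<close> and \<open>J h f - f\<close> are both
  \<open>h g + o(h)\<close>, so that \<open>n = t / h\<close> times their difference tends to 0. The index is shifted by one to
  keep the step size \<open>t / n\<close> defined.\<close>

lemma J_funpow_tendsto_T:
  assumes f: "gen f g" and t: "0 < t"
  shows "(\<lambda>n. (J (t / real (Suc n)) ^^ Suc n) f) \<longlonglongrightarrow> T t f"
proof -
  define h where "h n = t / real (Suc n)" for n
  have h: "0 < h n" "real (Suc n) * h n = t" for n
    using t by (simp_all add: h_def)
  have "h \<longlonglongrightarrow> 0"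
    unfolding h_def by (rule LIMSEQ_Suc[OF lim_const_over_n])
  then have lim: "filterlim h (at_right 0) sequentially"
    using h by (auto simp: filterlim_at less_imp_neq[THEN not_sym])
  have "(\<lambda>n. T t f - (J (h n) ^^ Suc n) f) \<longlonglongrightarrow> 0"
  proof (rule tendsto_norm_zero_cancel, rule tendsto_sandwich[OF _ _ tendsto_const])
    have "((\<lambda>h. t * norm ((T h f - f) /\<^sub>R h - J h g)) \<longlongrightarrow> t * norm (g - g)) (at_right 0)"
      using f J_tendsto unfolding gen_def by (intro tendsto_intros)
    then show "(\<lambda>n. t * norm ((T (h n) f - f) /\<^sub>R h n - J (h n) g)) \<longlonglongrightarrow> 0"
      using filterlim_compose[OF _ lim] by fastforce
    show "\<forall>\<^sub>F n in sequentially. norm (T t f - (J (h n) ^^ Suc n) f)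
      \<le> t * norm ((T (h n) f - f) /\<^sub>R h n - J (h n) g)"
    proof (rule always_eventually, rule allI)
      fix n
      have "T (h n) f - J (h n) f = h n *\<^sub>R ((T (h n) f - f) /\<^sub>R h n - J (h n) g)"
        using J_minus_id[OF f h(1)[of n]] h(1)[of n]
        by (simp add: scaleR_diff_right algebra_simps)
      then have "real (Suc n) * norm (T (h n) f - J (h n) f)
        = (real (Suc n) * h n) * norm ((T (h n) f - f) /\<^sub>R h n - J (h n) g)"
        using h(1)[of n] by (simp del: of_nat_Suc)
      then show "norm (T t f - (J (h n) ^^ Suc n) f)
        \<le> t * norm ((T (h n) f - f) /\<^sub>R h n - J (h n) g)"
        using norm_T_funpow_minus_J_funpow_le[OF h(1)[of n], of "Suc n" f] h(2)[of n]
        by (simp del: of_nat_Suc funpow.simps)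
    qed
  qed simp
  then show ?thesis
    unfolding h_def using tendsto_diff[OF tendsto_const[of "T t f"]] by fastforce
qed

text \<open>For \<open>f\<close> outside of the domain of the generator, use the exponential formula for \<open>J h f\<close>, which
  lies in the domain and in \<open>K\<close>, and then let \<open>h\<close> tend to 0.\<close>

theorem invariant_if_resolvent_invariant:
  assumes K: "closed K" and J: "\<And>h f. 0 < h \<Longrightarrow> f \<in> K \<Longrightarrow> J h f \<in> K"
    and f: "f \<in> K" and t: "0 \<le> t"
  shows "T t f \<in> K"
proof (cases "t = 0")
  case False
  with t have t: "0 < t" by simp
  have funpow: "(J h ^^ n) g \<in> K" if "0 < h" "g \<in> K" for h n g
    using that by (induction n) (auto intro: J)
  have dom: "T t (J h f) \<in> K" if h: "0 < h" for h
    by (rule closed_sequentially[OF K _ J_funpow_tendsto_T[OF gen_J[OF h] t]])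
      (intro funpow J h f, use t in simp)
  have "((\<lambda>h. T t (J h f)) \<longlongrightarrow> T t f) (at_right 0)"
    using t by (intro bounded_linear.tendsto[OF bounded_linear] J_tendsto) simp
  then show ?thesis
    by (rule Lim_in_closed_set[OF K, rotated 2])
      (use eventually_pos dom in \<open>auto elim: eventually_mono\<close>)
qed (use f in simp)

end

section \<open>Exponential kernels on the half-line\<close>

lemma space_halfline [simp]: "space halfline = {0..}"
  by (simp add: halfline_def space_restrict_space)

lemma sets_halfline [measurable_cong]: "sets halfline = sets (restrict_space borel {0..})"
  unfolding halfline_def by (intro sets_restrict_space_cong) simp

lemma borel_measurable_halflineI [measurable (raw)]: "f \<in> borel_measurable borel \<Longrightarrow> f \<in> borel_measurable halfline"
  unfolding halfline_def by (intro measurable_restrict_space1) simp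

interpretation halfline: sigma_finite_measure halfline
  unfolding halfline_def by (rule sigma_finite_measure_restrict_space) (simp_all add: lborel.sigma_finite_measure_axioms)

interpretation halfline: pair_sigma_finite halfline halfline ..

lemma AE_halfline_iff: "(AE x in halfline. P x) \<longleftrightarrow> (AE x in lborel. 0 \<le> x \<longrightarrow> P x)"
  unfolding halfline_def by (subst AE_restrict_space_iff) simp_all

lemma AE_halfline_nonneg: "AE x in halfline. 0 \<le> x"
  by (simp add: AE_halfline_iff)

lemma AE_halfline_neq: "AE x in halfline. x \<noteq> c"
  unfolding AE_halfline_iff using AE_lborel_singleton[of c] by eventually_elim simp

lemma AE_halfline_const: "(AE x in halfline. P) \<Longrightarrow> P"
proof (rule ccontr)
  assume *: "AE x in halfline. P" "\<not> P"
  then have "AE x in lborel. \<not> (0 \<le> (x :: real))" by (simp add: AE_halfline_iff)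
  then have "AE x in lborel. x \<notin> {0..(1 :: real)}" by eventually_elim simp
  then have "emeasure lborel {0..(1 :: real)} = 0"
    using AE_iff_null_sets[of "{0..(1 :: real)}" lborel] by (auto simp: null_sets_def)
  then show False by simp
qed

text \<open>Convolution with the fundamental solution \<open>exp (-\<kappa>|x - y|)\<close> of a second order equation is split
  into its parts from \<open>y \<le> x\<close> and from \<open>y \<ge> x\<close>, each of which solves an equation of first order. The
  second part has the transposed kernel.\<close>

definition fwd :: "real \<Rightarrow> real \<Rightarrow> real \<Rightarrow> real"
  where "fwd \<kappa> x y = (if y \<le> x then exp (- \<kappa> * (x - y)) else 0)"

lemma fwd_measurable [measurable]: "(\<lambda>(x, y). fwd \<kappa> x y) \<in> borel_measurable (borel \<Otimes>\<^sub>M borel)"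
  unfolding fwd_def by measurable

lemma fwd_bounds: "0 < \<kappa> \<Longrightarrow> 0 \<le> fwd \<kappa> x y" "0 < \<kappa> \<Longrightarrow> fwd \<kappa> x y \<le> 1"
  by (auto simp: fwd_def)

lemma has_bochner_integral_halfline_iff:
  fixes f :: "real \<Rightarrow> 'b::{banach, second_countable_topology}"
  shows "has_bochner_integral halfline f c \<longleftrightarrow> has_bochner_integral lborel (\<lambda>x. indicator {0..} x *\<^sub>R f x) c"
  by (simp add: has_bochner_integral_iff halfline_def integrable_restrict_space integral_restrict_space)

lemma has_bochner_integral_fwd_2:
  assumes "0 < \<kappa>" "0 \<le> x"
  shows "has_bochner_integral halfline (\<lambda>y. fwd \<kappa> x y) ((1 - exp (- \<kappa> * x)) / \<kappa>)"
proof -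
  have "has_bochner_integral lborel (\<lambda>y. exp (- \<kappa> * (x - y)) * indicator {0..x} y)
    (exp (- \<kappa> * (x - x)) / \<kappa> - exp (- \<kappa> * (x - 0)) / \<kappa>)"
  proof (rule has_bochner_integral_FTC_Icc_real)
    show "DERIV (\<lambda>y. exp (- \<kappa> * (x - y)) / \<kappa>) y :> exp (- \<kappa> * (x - y))" for y
      using assms by (auto intro!: derivative_eq_intros)
  qed (use assms in auto)
  moreover have "exp (- \<kappa> * (x - y)) * indicator {0..x} y = indicator {0..} y *\<^sub>R fwd \<kappa> x y" for y
    by (auto simp: indicator_def fwd_def)
  ultimately show ?thesis
    by (simp add: has_bochner_integral_halfline_iff diff_divide_distrib)
qed

lemma has_bochner_integral_fwd_1:
  assumes "0 < \<kappa>" "0 \<le> y"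
  shows "has_bochner_integral halfline (\<lambda>x. fwd \<kappa> x y) (1 / \<kappa>)"
proof -
  have *: "ennreal (exp (- \<kappa> * (x - y))) * indicator {y..} x = ennreal (indicator {0..} x *\<^sub>R fwd \<kappa> x y)" for x
    using assms by (auto simp: indicator_def fwd_def)
  have "((\<lambda>x. - exp (- \<kappa> * (x - y)) / \<kappa>) \<longlongrightarrow> 0) at_top"
    using assms(1) by real_asymp
  then have "(\<integral>\<^sup>+ x. ennreal (exp (- \<kappa> * (x - y))) * indicator {y..} x \<partial>lborel)
    = ennreal (0 - (- exp (- \<kappa> * (y - y)) / \<kappa>))"
    using assms by (intro nn_integral_FTC_atLeast) (auto intro!: derivative_eq_intros)
  then show ?thesis
    using assms unfolding has_bochner_integral_halfline_iff *
    by (intro has_bochner_integral_nn_integral) (auto simp: fwd_bounds)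
qed

section \<open>Schur kernels\<close>

definition kernel_op :: "(real \<Rightarrow> real \<Rightarrow> real) \<Rightarrow> (real \<Rightarrow> complex) \<Rightarrow> real \<Rightarrow> complex"
  where "kernel_op k f x = (\<integral>y. of_real (k x y) * f y \<partial>halfline)"

text \<open>The bounds on both marginals are those of the Schur test; they make the operator bounded on
  \<open>L\<^sup>2\<close>. The bound \<open>k \<le> 1\<close> makes all integrals converge at every \<open>x \<ge> 0\<close>, not only almost
  everywhere, so that \<open>kernel_op k f\<close> is a function that can be evaluated at 0.\<close>

locale schur_kernel =
  fixes k :: "real \<Rightarrow> real \<Rightarrow> real" and M :: real
  assumes measurable_kernel: "(\<lambda>(x, y). k x y) \<in> borel_measurable (borel \<Otimes>\<^sub>M borel)"
    and nonneg: "0 \<le> k x y" and le_1: "k x y \<le> 1"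
    and integrable_fst: "0 \<le> y \<Longrightarrow> integrable halfline (\<lambda>x. k x y)"
    and integrable_snd: "0 \<le> x \<Longrightarrow> integrable halfline (k x)"
    and integral_fst: "0 \<le> y \<Longrightarrow> (\<integral>x. k x y \<partial>halfline) \<le> M"
    and integral_snd: "0 \<le> x \<Longrightarrow> (\<integral>y. k x y \<partial>halfline) \<le> M"
begin

lemma borel_measurable_kernel:
  assumes "f \<in> borel_measurable N" "g \<in> borel_measurable N"
  shows "(\<lambda>p. k (f p) (g p)) \<in> borel_measurable N"
  using measurable_compose[OF measurable_Pair[OF assms] measurable_kernel] by simp

lemma borel_measurable_kernel_halfline [measurable (raw)]:
  assumes "f \<in> N \<rightarrow>\<^sub>M halfline" "g \<in> N \<rightarrow>\<^sub>M halfline"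
  shows "(\<lambda>p. k (f p) (g p)) \<in> borel_measurable N"
  using assms[THEN measurable_compose, OF borel_measurable_halflineI[OF measurable_ident_sets[OF refl]]]
  by (rule borel_measurable_kernel)

lemma borel_measurable_kernel_const [measurable]: "k x \<in> borel_measurable halfline"
  using borel_measurable_kernel[of "\<lambda>_. x" halfline "\<lambda>y. y"]
    borel_measurable_halflineI[OF measurable_ident_sets[OF refl]] by simp

lemma transpose: "schur_kernel (\<lambda>x y. k y x) M"
  using measurable_kernel
  by unfold_locales (auto simp: nonneg le_1 integrable_fst integrable_snd integral_fst integral_snd)

lemma integrable_kernel_mult:
  assumes f: "integrable halfline (f :: real \<Rightarrow> real)"
  shows "integrable halfline (\<lambda>y. k x y * f y)"
proof (rule Bochner_Integration.integrable_bound[OF f])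
  note [measurable] = borel_measurable_integrable[OF f]
  show "(\<lambda>y. k x y * f y) \<in> borel_measurable halfline" by measurable
  show "AE y in halfline. norm (k x y * f y) \<le> norm (f y)"
    using nonneg le_1 by (auto simp: abs_mult mult_left_le_one_le)
qed

lemma integrable_kernel_norm:
  assumes f: "square_integrable f" and x: "0 \<le> x"
  shows "integrable halfline (\<lambda>y. k x y * cmod (f y))"
proof (rule Bochner_Integration.integrable_bound)
  note [measurable] = square_integrable_measurable[OF f]
  show "integrable halfline (\<lambda>y. k x y + k x y * (cmod (f y))\<^sup>2)"
    using f x by (intro Bochner_Integration.integrable_add integrable_snd integrable_kernel_mult)
      (auto simp: square_integrable_def)
  show "(\<lambda>y. k x y * cmod (f y)) \<in> borel_measurable halfline" by measurable
  have "cmod (f y) \<le> 1 + (cmod (f y))\<^sup>2" for y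
    using sum_squares_bound[of 1 "cmod (f y)"] norm_ge_zero[of "f y"] unfolding power_one by linarith
  from mult_left_mono[OF this nonneg]
  show "AE y in halfline. norm (k x y * cmod (f y)) \<le> norm (k x y + k x y * (cmod (f y))\<^sup>2)"
    using nonneg by (auto simp: abs_mult distrib_left)
qed

lemma integrable_kernel:
  assumes f: "square_integrable f" and x: "0 \<le> x"
  shows "integrable halfline (\<lambda>y. of_real (k x y) * f y)"
proof (rule Bochner_Integration.integrable_bound[OF integrable_kernel_norm[OF assms]])
  note [measurable] = square_integrable_measurable[OF f]
  show "(\<lambda>y. of_real (k x y) * f y) \<in> borel_measurable halfline" by measurable
qed (auto simp: norm_mult nonneg)

lemma integrable_pair:
  assumes g: "integrable halfline g" and g0: "\<And>y. 0 \<le> (g y :: real)"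
  shows "integrable (halfline \<Otimes>\<^sub>M halfline) (\<lambda>(x, y). k x y * g y)"
proof -
  note [measurable] = borel_measurable_integrable[OF g]
  have "integrable (halfline \<Otimes>\<^sub>M halfline) (\<lambda>(y, x). k x y * g y)"
  proof (rule halfline.Fubini_integrable)
    show "(\<lambda>(y, x). k x y * g y) \<in> borel_measurable (halfline \<Otimes>\<^sub>M halfline)" by measurable
    show "AE y in halfline. integrable halfline (\<lambda>x. case (y, x) of (y, x) \<Rightarrow> k x y * g y)"
      using AE_halfline_nonneg by eventually_elim (auto intro: integrable_fst)
    have "(\<lambda>y. \<integral>x. norm (case (y, x) of (y, x) \<Rightarrow> k x y * g y) \<partial>halfline)
      = (\<lambda>y. (\<integral>x. k x y \<partial>halfline) * g y)"
      by (simp add: abs_mult nonneg g0)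
    moreover have "integrable halfline (\<lambda>y. (\<integral>x. k x y \<partial>halfline) * g y)"
    proof (rule Bochner_Integration.integrable_bound)
      show "integrable halfline (\<lambda>y. M * g y)" using g by simp
      show "AE y in halfline. norm ((\<integral>x. k x y \<partial>halfline) * g y) \<le> norm (M * g y)"
        using AE_halfline_nonneg
      proof eventually_elim
        case (elim y)
        have "(\<integral>x. k x y \<partial>halfline) * g y \<le> M * g y"
          using integral_fst[OF elim] g0 by (rule mult_right_mono)
        moreover have "0 \<le> (\<integral>x. k x y \<partial>halfline) * g y" using g0 nonneg by simp
        ultimately show ?case by simp
      qed
    qed measurable
    ultimately show "integrable halfline
      (\<lambda>y. \<integral>x. norm (case (y, x) of (y, x) \<Rightarrow> k x y * g y) \<partial>halfline)" by simp
  qed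
  from halfline.integrable_product_swap[OF this] show ?thesis by simp
qed

text \<open>The Schur test: by the Cauchy-Schwarz inequality with weight \<open>k x\<close>, the square of the operator at
  \<open>x\<close> is at most \<open>M \<integral> k(x,y) |f(y)|\<^sup>2 dy\<close>, which is integrable by Tonelli's theorem.\<close>

lemma square_integrable_kernel_op:
  assumes f: "square_integrable f"
  shows "square_integrable (kernel_op k f)"
proof -
  note [measurable] = square_integrable_measurable[OF f]
  define Q where "Q x = (\<integral>y. k x y * (cmod (f y))\<^sup>2 \<partial>halfline)" for x
  have meas [measurable]: "kernel_op k f \<in> borel_measurable halfline"
    unfolding kernel_op_def by measurable
  have f2: "integrable halfline (\<lambda>y. (cmod (f y))\<^sup>2)"
    using f by (simp add: square_integrable_def)
  have Q: "integrable halfline Q"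
    using halfline.integrable_fst'[OF integrable_pair[OF f2]] by (simp add: Q_def[abs_def])
  have M: "0 \<le> M" using integral_snd[of 0] nonneg by (meson Bochner_Integration.integral_nonneg order.refl order.trans)
  have bound: "(cmod (kernel_op k f x))\<^sup>2 \<le> M * Q x" if x: "0 \<le> x" for x
  proof -
    define N m where "N = (\<integral>y. k x y * cmod (f y) \<partial>halfline)" and "m = (\<integral>y. k x y \<partial>halfline)"
    note int = integrable_snd[OF x] integrable_kernel_norm[OF f x] integrable_kernel_mult[OF f2, of x]
    have N: "cmod (kernel_op k f x) \<le> N"
      unfolding kernel_op_def N_def
      by (rule Bochner_Integration.integral_norm_bound_integral[OF integrable_kernel[OF f x] int(2)]) (auto simp: norm_mult nonneg)
    (* Cauchy-Schwarz: the square of r - |f| has a nonnegative integral for every r.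
       The best choice is r = N / M if M is positive. *)
    have quad: "2 * r * N \<le> r\<^sup>2 * M + Q x" for r
    proof -
      have "0 \<le> (\<integral>y. k x y * (r - cmod (f y))\<^sup>2 \<partial>halfline)"
        using nonneg by simp
      also have "\<dots> = (\<integral>y. r\<^sup>2 * k x y + (k x y * (cmod (f y))\<^sup>2 - 2 * r * (k x y * cmod (f y))) \<partial>halfline)"
        by (intro Bochner_Integration.integral_cong) (auto simp: power2_diff algebra_simps)
      also have "\<dots> = r\<^sup>2 * m + (Q x - 2 * r * N)"
        unfolding Q_def N_def m_def using int
        by (subst Bochner_Integration.integral_add Bochner_Integration.integral_diff; simp)+
      also have "\<dots> \<le> r\<^sup>2 * M + (Q x - 2 * r * N)"
        using integral_snd[OF x] by (intro add_mono mult_left_mono) (auto simp: m_def)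
      finally show ?thesis by simp
    qed
    have "N\<^sup>2 \<le> M * Q x"
    proof (cases "M = 0")
      case True
      have "N = 0"
      proof (rule ccontr)
        assume "N \<noteq> 0"
        then show False using quad[of "(Q x + 1) / (2 * N)"] True by simp
      qed
      then show ?thesis using True by simp
    next
      case False
      then show ?thesis using quad[of "N / M"] M by (simp add: power2_eq_square field_simps)
    qed
    moreover have "(cmod (kernel_op k f x))\<^sup>2 \<le> N\<^sup>2" using N by (intro power_mono) auto
    ultimately show ?thesis by simp
  qed
  have "integrable halfline (\<lambda>x. (cmod (kernel_op k f x))\<^sup>2)"
  proof (rule Bochner_Integration.integrable_bound)
    show "integrable halfline (\<lambda>x. M * Q x)" using Q by simp
    show "AE x in halfline. norm ((cmod (kernel_op k f x))\<^sup>2) \<le> norm (M * Q x)"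
      using AE_halfline_nonneg
    proof eventually_elim
      case (elim x) then show ?case using bound[of x] by (simp add: abs_le_iff)
    qed
  qed measurable
  then show ?thesis by (simp add: square_integrable_def)
qed

lemma integral_kernel_op_mult:
  assumes f: "square_integrable f" and g: "square_integrable g"
  shows "(\<integral>x. kernel_op k f x * g x \<partial>halfline)
    = (\<integral>y. f y * kernel_op (\<lambda>x y. k y x) g y \<partial>halfline)"
proof -
  note [measurable] = square_integrable_measurable[OF f] square_integrable_measurable[OF g]
  define F where "F = (\<lambda>(x, y). of_real (k x y) * f y * g x)"
  have F: "F \<in> borel_measurable (halfline \<Otimes>\<^sub>M halfline)" unfolding F_def by measurable
  interpret t: schur_kernel "\<lambda>x y. k y x" M by (rule transpose)
  have "integrable (halfline \<Otimes>\<^sub>M halfline) F"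
  proof (rule Bochner_Integration.integrable_bound)
    have f2: "integrable halfline (\<lambda>y. (cmod (f y))\<^sup>2)" and g2: "integrable halfline (\<lambda>y. (cmod (g y))\<^sup>2)"
      using f g by (auto simp: square_integrable_def)
    show "integrable (halfline \<Otimes>\<^sub>M halfline)
        (\<lambda>p. (case p of (x, y) \<Rightarrow> k x y * (cmod (f y))\<^sup>2) + (case p of (x, y) \<Rightarrow> k x y * (cmod (g x))\<^sup>2))"
      using halfline.integrable_product_swap[OF t.integrable_pair[OF g2]] integrable_pair[OF f2]
      by (intro Bochner_Integration.integrable_add) auto
    show "F \<in> borel_measurable (halfline \<Otimes>\<^sub>M halfline)" by (rule F)
    have "cmod (F (x, y)) \<le> k x y * (cmod (f y))\<^sup>2 + k x y * (cmod (g x))\<^sup>2" for x y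
    proof -
      have "0 \<le> cmod (f y) * cmod (g x)" by simp
      then have "cmod (f y) * cmod (g x) \<le> (cmod (f y))\<^sup>2 + (cmod (g x))\<^sup>2"
        using sum_squares_bound[of "cmod (f y)" "cmod (g x)"] by linarith
      from mult_left_mono[OF this nonneg[of x y]] show ?thesis
        by (simp add: F_def norm_mult nonneg distrib_left mult.assoc)
    qed
    then show "AE p in halfline \<Otimes>\<^sub>M halfline. norm (F p) \<le>
      norm ((case p of (x, y) \<Rightarrow> k x y * (cmod (f y))\<^sup>2) + (case p of (x, y) \<Rightarrow> k x y * (cmod (g x))\<^sup>2))"
      by (intro AE_I2) (auto intro: order.trans[OF _ abs_ge_self])
  qed
  then have "(\<integral>y. \<integral>x. F (x, y) \<partial>halfline \<partial>halfline) = (\<integral>x. \<integral>y. F (x, y) \<partial>halfline \<partial>halfline)"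
    by (intro halfline.Fubini_integral) (simp add: case_prod_unfold)
  moreover have "(\<integral>y. F (x, y) \<partial>halfline) = kernel_op k f x * g x" for x
    by (simp add: F_def kernel_op_def)
  moreover have "(\<integral>x. F (x, y) \<partial>halfline) = f y * kernel_op (\<lambda>x y. k y x) g y" for y
  proof -
    have "(\<integral>x. F (x, y) \<partial>halfline) = (\<integral>x. f y * (of_real (k x y) * g x) \<partial>halfline)"
      by (simp add: F_def mult_ac)
    then show ?thesis by (simp add: kernel_op_def)
  qed
  ultimately show ?thesis by simp
qed

end

lemma schur_kernel_fwd: "0 < \<kappa> \<Longrightarrow> schur_kernel (fwd \<kappa>) (1 / \<kappa>)"
  using has_bochner_integral_fwd_1[of \<kappa>] has_bochner_integral_fwd_2[of \<kappa>]
  by unfold_locales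
    (auto simp: fwd_bounds has_bochner_integral_iff intro!: divide_right_mono)

abbreviation fwd_op :: "real \<Rightarrow> (real \<Rightarrow> complex) \<Rightarrow> real \<Rightarrow> complex"
  where "fwd_op \<kappa> \<equiv> kernel_op (fwd \<kappa>)"

abbreviation bwd_op :: "real \<Rightarrow> (real \<Rightarrow> complex) \<Rightarrow> real \<Rightarrow> complex"
  where "bwd_op \<kappa> \<equiv> kernel_op (\<lambda>x y. fwd \<kappa> y x)"

section \<open>Weak derivatives of the exponential convolutions\<close>

lemma test_function_props:
  assumes "test_function \<phi>"
  obtains a b where "0 < a" "\<forall>x. x \<notin> {a..b} \<longrightarrow> \<phi> x = 0 \<and> deriv \<phi> x = 0"
    "\<forall>x. (\<phi> has_real_derivative deriv \<phi> x) (at x)"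
    "continuous_on UNIV \<phi>" "continuous_on UNIV (deriv \<phi>)"
proof -
  from assms have d: "(deriv ^^ n) \<phi> field_differentiable at x" for n x
    by (simp add: test_function_def)
  have d1: "(\<phi> has_real_derivative deriv \<phi> x) (at x)" for x
    using d[of 0 x] by (simp add: field_differentiable_derivI)
  from assms obtain a b where ab: "0 < a" "\<And>x. x \<notin> {a..b} \<Longrightarrow> \<phi> x = 0"
    by (auto simp: test_function_def)
  have "deriv \<phi> x = 0" if "x \<notin> {a..b}" for x
  proof -
    have "((\<lambda>_. 0) has_real_derivative deriv \<phi> x) (at x)"
      by (rule DERIV_cong_ev[THEN iffD1, OF refl _ refl d1[of x]])
        (use that ab(2) in \<open>auto simp: eventually_nhds intro!: exI[of _ "- {a..b}"]\<close>)
    then show ?thesis using DERIV_const DERIV_unique by blast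
  qed
  moreover have "continuous_on UNIV \<phi>" "continuous_on UNIV (deriv \<phi>)"
    using d[of 0] d[of 1]
    by (auto intro!: continuous_at_imp_continuous_on field_differentiable_imp_continuous_at)
  ultimately show ?thesis using that ab d1 by blast
qed

lemma square_integrable_compact_support:
  fixes h :: "real \<Rightarrow> real"
  assumes "continuous_on UNIV h" "\<And>x. x \<notin> {a..b} \<Longrightarrow> h x = 0"
  shows "square_integrable (\<lambda>x. of_real (h x))"
proof -
  have [measurable]: "h \<in> borel_measurable borel"
    using assms(1) by (rule borel_measurable_continuous_onI)
  have "integrable lborel (\<lambda>x. indicator {a..b} x *\<^sub>R (h x)\<^sup>2)"
    by (intro borel_integrable_compact continuous_intros continuous_on_subset[OF assms(1)]) auto
  then have "integrable lborel (\<lambda>x. indicator {0..} x *\<^sub>R (h x)\<^sup>2)"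
    by (rule Bochner_Integration.integrable_bound) (use assms(2) in \<open>auto simp: indicator_def\<close>)
  then have "integrable halfline (\<lambda>x. (h x)\<^sup>2)"
    by (simp add: halfline_def integrable_restrict_space)
  then show ?thesis
    by (simp add: square_integrable_def)
qed

lemma square_integrable_test_function:
  assumes "test_function \<phi>"
  shows "square_integrable (\<lambda>x. of_real (\<phi> x))" "square_integrable (\<lambda>x. of_real (deriv \<phi> x))"
proof -
  obtain a b where p: "0 < a" "\<forall>x. x \<notin> {a..b} \<longrightarrow> \<phi> x = 0 \<and> deriv \<phi> x = 0"
    "\<forall>x. (\<phi> has_real_derivative deriv \<phi> x) (at x)"
    "continuous_on UNIV \<phi>" "continuous_on UNIV (deriv \<phi>)"
    by (rule test_function_props[OF assms])
  show "square_integrable (\<lambda>x. of_real (\<phi> x))" "square_integrable (\<lambda>x. of_real (deriv \<phi> x))"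
    using square_integrable_compact_support[OF p(4), of a b] square_integrable_compact_support[OF p(5), of a b] using p(2) by auto
qed

lemma integrable_mult_square_integrable:
  assumes "square_integrable f" "square_integrable g"
  shows "integrable halfline (\<lambda>x. f x * g x)"
proof (rule Bochner_Integration.integrable_bound)
  note [measurable] = assms[THEN square_integrable_measurable]
  show "integrable halfline (\<lambda>x. (cmod (f x))\<^sup>2 + (cmod (g x))\<^sup>2)"
    using assms by (simp add: square_integrable_def)
  show "(\<lambda>x. f x * g x) \<in> borel_measurable halfline" by measurable
  have "cmod (f x) * cmod (g x) \<le> (cmod (f x))\<^sup>2 + (cmod (g x))\<^sup>2" for x
    using sum_squares_bound[of "cmod (f x)" "cmod (g x)"] mult_nonneg_nonneg[of "cmod (f x)" "cmod (g x)"]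
    by (simp del: mult_nonneg_nonneg)
  then show "AE x in halfline. norm (f x * g x) \<le> norm ((cmod (f x))\<^sup>2 + (cmod (g x))\<^sup>2)"
    by (simp add: norm_mult)
qed

lemma halfline_integral_of_real:
  "(\<integral>x. of_real (h x) \<partial>halfline) = (of_real (\<integral>x. indicator {0..} x * h x \<partial>lborel) :: complex)"
  by (simp add: halfline_def integral_restrict_space)

text \<open>This lemma and the next evaluate the transposed operator on the right hand side of the formal
  adjoint equation. Both are the fundamental theorem of calculus for \<open>\<phi>\<close> times an exponential; the
  terms at 0 and at infinity vanish since the support of \<open>\<phi>\<close> is compact in \<open>(0,\<infinity>)\<close>.\<close>

lemma bwd_op_test_function:
  assumes \<phi>: "test_function \<phi>" and y: "0 \<le> y"
  shows "bwd_op \<kappa> (\<lambda>x. of_real (deriv \<phi> x - \<kappa> * \<phi> x)) y = - of_real (\<phi> y)"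
proof -
  obtain a b where p: "0 < a" "\<forall>x. x \<notin> {a..b} \<longrightarrow> \<phi> x = 0 \<and> deriv \<phi> x = 0"
    "\<forall>x. (\<phi> has_real_derivative deriv \<phi> x) (at x)"
    "continuous_on UNIV \<phi>" "continuous_on UNIV (deriv \<phi>)"
    by (rule test_function_props[OF \<phi>])
  define B where "B = max y b + 1"
  have B: "y < B" "b < B" by (auto simp: B_def)
  define F where "F x = exp (- \<kappa> * (x - y)) * \<phi> x" for x
  define F' where "F' x = exp (- \<kappa> * (x - y)) * (deriv \<phi> x - \<kappa> * \<phi> x)" for x
  have "(\<integral>x. F' x * indicator {y..B} x \<partial>lborel) = F B - F y"
  proof (rule integral_FTC_Icc_real)
    show "y \<le> B" using B by simp
    show "(F has_real_derivative F' x) (at x)" for x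
      unfolding F_def F'_def by (auto intro!: derivative_eq_intros p(3)[rule_format] simp: algebra_simps)
    show "isCont F' x" for x
      using p(4,5) unfolding F'_def by (auto intro!: continuous_intros simp: continuous_on_eq_continuous_at)
  qed
  moreover have "F' x * indicator {y..B} x = indicator {0..} x * (fwd \<kappa> x y * (deriv \<phi> x - \<kappa> * \<phi> x))" for x
    using y B p(2)[rule_format, of x] by (auto simp: F'_def fwd_def indicator_def)
  moreover have "F B = 0" using p(2)[rule_format, of B] B by (simp add: F_def)
  ultimately show ?thesis
    unfolding kernel_op_def of_real_mult[symmetric] halfline_integral_of_real
    by (simp add: F_def)
qed

lemma fwd_op_test_function:
  assumes \<phi>: "test_function \<phi>" and y: "0 \<le> y"
  shows "fwd_op \<kappa> (\<lambda>x. of_real (deriv \<phi> x + \<kappa> * \<phi> x)) y = of_real (\<phi> y)"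
proof -
  obtain a b where p: "0 < a" "\<forall>x. x \<notin> {a..b} \<longrightarrow> \<phi> x = 0 \<and> deriv \<phi> x = 0"
    "\<forall>x. (\<phi> has_real_derivative deriv \<phi> x) (at x)"
    "continuous_on UNIV \<phi>" "continuous_on UNIV (deriv \<phi>)"
    by (rule test_function_props[OF \<phi>])
  define F where "F x = exp (- \<kappa> * (y - x)) * \<phi> x" for x
  define F' where "F' x = exp (- \<kappa> * (y - x)) * (deriv \<phi> x + \<kappa> * \<phi> x)" for x
  have "(\<integral>x. F' x * indicator {0..y} x \<partial>lborel) = F y - F 0"
  proof (rule integral_FTC_Icc_real[OF y])
    show "(F has_real_derivative F' x) (at x)" for x
      unfolding F_def F'_def by (auto intro!: derivative_eq_intros p(3)[rule_format] simp: algebra_simps)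
    show "isCont F' x" for x
      using p(4,5) unfolding F'_def by (auto intro!: continuous_intros simp: continuous_on_eq_continuous_at)
  qed
  moreover have "F' x * indicator {0..y} x = indicator {0..} x * (fwd \<kappa> y x * (deriv \<phi> x + \<kappa> * \<phi> x))" for x
    by (auto simp: F'_def fwd_def indicator_def)
  moreover have "F 0 = 0" using p(1) p(2)[rule_format, of 0] by (simp add: F_def)
  ultimately show ?thesis
    unfolding kernel_op_def of_real_mult[symmetric] halfline_integral_of_real
    by (simp add: F_def)
qed

text \<open>A version of \<^const>\<open>has_weak_deriv\<close> for functions instead of classes, with square
  integrability built in, so that the rules for sums and multiples have no side conditions.\<close>

definition weak_deriv :: "(real \<Rightarrow> complex) \<Rightarrow> (real \<Rightarrow> complex) \<Rightarrow> bool"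
  where "weak_deriv u v \<longleftrightarrow> square_integrable u \<and> square_integrable v \<and> (\<forall>\<phi>. test_function \<phi> \<longrightarrow>
    (\<integral>x. u x * of_real (deriv \<phi> x) \<partial>halfline) = - (\<integral>x. v x * of_real (\<phi> x) \<partial>halfline))"

lemma weak_deriv_add:
  assumes "weak_deriv u v" "weak_deriv u' v'"
  shows "weak_deriv (\<lambda>x. u x + u' x) (\<lambda>x. v x + v' x)"
  using assms unfolding weak_deriv_def
  by (auto simp: distrib_right integrable_mult_square_integrable square_integrable_test_function intro: square_integrable_add)

lemma weak_deriv_cmult:
  assumes "weak_deriv u v"
  shows "weak_deriv (\<lambda>x. c * u x) (\<lambda>x. c * v x)"
  using assms unfolding weak_deriv_def
  by (auto simp: mult.assoc intro: square_integrable_cmult)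

lemma weak_deriv_mult_right:
  assumes "weak_deriv u v"
  shows "weak_deriv (\<lambda>x. u x * c) (\<lambda>x. v x * c)"
  using weak_deriv_cmult[OF assms, of c] by (simp add: mult.commute)

lemma weak_deriv_diff:
  assumes "weak_deriv u v" "weak_deriv u' v'"
  shows "weak_deriv (\<lambda>x. u x - u' x) (\<lambda>x. v x - v' x)"
  using weak_deriv_add[OF assms(1) weak_deriv_cmult[OF assms(2), of "-1"]] by simp

text \<open>In the sense of distributions \<open>fwd_op \<kappa> f\<close> solves \<open>F' = f - \<kappa> F\<close>. By Fubini's theorem testing it
  with \<open>\<phi>' - \<kappa> \<phi>\<close> amounts to testing \<open>f\<close> with the transposed operator applied to that function, which is
  \<open>- \<phi>\<close>. The transposed operator is treated in the same way.\<close>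

lemma weak_deriv_fwd_op:
  assumes f: "square_integrable f" and \<kappa>: "0 < \<kappa>"
  shows "weak_deriv (fwd_op \<kappa> f) (\<lambda>x. f x - of_real \<kappa> * fwd_op \<kappa> f x)"
  unfolding weak_deriv_def
proof (intro conjI allI impI)
  interpret schur_kernel "fwd \<kappa>" "1 / \<kappa>" by (rule schur_kernel_fwd[OF \<kappa>])
  show u: "square_integrable (fwd_op \<kappa> f)" by (rule square_integrable_kernel_op[OF f])
  show "square_integrable (\<lambda>x. f x - of_real \<kappa> * fwd_op \<kappa> f x)"
    by (intro square_integrable_diff square_integrable_cmult f u)
  fix \<phi> assume \<phi>: "test_function \<phi>"
  note s = square_integrable_test_function[OF \<phi>]
  have "(\<integral>x. fwd_op \<kappa> f x * of_real (deriv \<phi> x - \<kappa> * \<phi> x) \<partial>halfline)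
    = (\<integral>y. f y * bwd_op \<kappa> (\<lambda>x. of_real (deriv \<phi> x - \<kappa> * \<phi> x)) y \<partial>halfline)"
    using s by (intro integral_kernel_op_mult f) (auto intro!: square_integrable_diff square_integrable_cmult)
  also have "\<dots> = (\<integral>y. - (f y * of_real (\<phi> y)) \<partial>halfline)"
    by (intro Bochner_Integration.integral_cong refl) (simp add: bwd_op_test_function[OF \<phi>] del: of_real_diff of_real_mult)
  finally have "(\<integral>x. fwd_op \<kappa> f x * of_real (deriv \<phi> x - \<kappa> * \<phi> x) \<partial>halfline)
    = - (\<integral>y. f y * of_real (\<phi> y) \<partial>halfline)" by simp
  then show "(\<integral>x. fwd_op \<kappa> f x * of_real (deriv \<phi> x) \<partial>halfline)
    = - (\<integral>x. (f x - of_real \<kappa> * fwd_op \<kappa> f x) * of_real (\<phi> x) \<partial>halfline)"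
    using integrable_mult_square_integrable[OF u s(1)] integrable_mult_square_integrable[OF u s(2)] integrable_mult_square_integrable[OF f s(1)]
    by (simp add: right_diff_distrib left_diff_distrib mult.left_commute mult.assoc diff_eq_eq)
qed

lemma weak_deriv_bwd_op:
  assumes f: "square_integrable f" and \<kappa>: "0 < \<kappa>"
  shows "weak_deriv (bwd_op \<kappa> f) (\<lambda>x. of_real \<kappa> * bwd_op \<kappa> f x - f x)"
  unfolding weak_deriv_def
proof (intro conjI allI impI)
  interpret schur_kernel "\<lambda>x y. fwd \<kappa> y x" "1 / \<kappa>"
    by (rule schur_kernel.transpose[OF schur_kernel_fwd[OF \<kappa>]])
  show u: "square_integrable (bwd_op \<kappa> f)" by (rule square_integrable_kernel_op[OF f])
  show "square_integrable (\<lambda>x. of_real \<kappa> * bwd_op \<kappa> f x - f x)"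
    by (intro square_integrable_diff square_integrable_cmult f u)
  fix \<phi> assume \<phi>: "test_function \<phi>"
  note s = square_integrable_test_function[OF \<phi>]
  have "(\<integral>x. bwd_op \<kappa> f x * of_real (deriv \<phi> x + \<kappa> * \<phi> x) \<partial>halfline)
    = (\<integral>y. f y * fwd_op \<kappa> (\<lambda>x. of_real (deriv \<phi> x + \<kappa> * \<phi> x)) y \<partial>halfline)"
    using s by (intro integral_kernel_op_mult f) (auto intro!: square_integrable_add square_integrable_cmult)
  also have "\<dots> = (\<integral>y. f y * of_real (\<phi> y) \<partial>halfline)"
    by (intro Bochner_Integration.integral_cong refl) (simp add: fwd_op_test_function[OF \<phi>] del: of_real_add of_real_mult)
  finally show "(\<integral>x. bwd_op \<kappa> f x * of_real (deriv \<phi> x) \<partial>halfline)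
    = - (\<integral>x. (of_real \<kappa> * bwd_op \<kappa> f x - f x) * of_real (\<phi> x) \<partial>halfline)"
    using integrable_mult_square_integrable[OF u s(1)] integrable_mult_square_integrable[OF u s(2)] integrable_mult_square_integrable[OF f s(1)]
    by (simp add: distrib_left left_diff_distrib mult.left_commute mult.assoc eq_diff_eq)
qed

lemma square_integrable_exp:
  assumes "0 < \<kappa>"
  shows "square_integrable (\<lambda>x. of_real (exp (- \<kappa> * x)))"
proof -
  have "integrable halfline (\<lambda>x. fwd (2 * \<kappa>) x 0)"
    using has_bochner_integral_fwd_1[of "2 * \<kappa>" 0] assms by (simp add: has_bochner_integral_iff)
  moreover have "integrable halfline (\<lambda>x. fwd (2 * \<kappa>) x 0) \<longleftrightarrow> integrable halfline (\<lambda>x. (exp (- \<kappa> * x))\<^sup>2)"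
    by (intro Bochner_Integration.integrable_cong refl) (auto simp: fwd_def power2_eq_square simp flip: exp_add)
  ultimately show ?thesis by (simp add: square_integrable_def)
qed

text \<open>The integral of \<open>exp (-\<kappa>x)\<close> against a test function is the value of a \<open>bwd_op\<close> at 0.\<close>

lemma weak_deriv_exp:
  assumes \<kappa>: "0 < \<kappa>"
  shows "weak_deriv (\<lambda>x. of_real (exp (- \<kappa> * x))) (\<lambda>x. - of_real \<kappa> * of_real (exp (- \<kappa> * x)))"
  unfolding weak_deriv_def
proof (intro conjI allI impI)
  let ?e = "\<lambda>x. complex_of_real (exp (- \<kappa> * x))"
  show e: "square_integrable ?e" by (rule square_integrable_exp[OF \<kappa>])
  then show "square_integrable (\<lambda>x. - of_real \<kappa> * ?e x)" by (rule square_integrable_cmult)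
  fix \<phi> assume \<phi>: "test_function \<phi>"
  note s = square_integrable_test_function[OF \<phi>]
  have "\<phi> 0 = 0" using \<phi> by (auto simp: test_function_def)
  have "(\<integral>x. ?e x * of_real (deriv \<phi> x - \<kappa> * \<phi> x) \<partial>halfline)
    = bwd_op \<kappa> (\<lambda>x. of_real (deriv \<phi> x - \<kappa> * \<phi> x)) 0"
    unfolding kernel_op_def by (intro Bochner_Integration.integral_cong refl) (simp add: fwd_def)
  also have "\<dots> = 0" using \<open>\<phi> 0 = 0\<close> by (simp add: bwd_op_test_function[OF \<phi>] del: of_real_diff of_real_mult)
  finally show "(\<integral>x. ?e x * of_real (deriv \<phi> x) \<partial>halfline)
    = - (\<integral>x. (- of_real \<kappa> * ?e x) * of_real (\<phi> x) \<partial>halfline)"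
    using integrable_mult_square_integrable[OF e s(1)] integrable_mult_square_integrable[OF e s(2)]
    by (simp add: right_diff_distrib mult.left_commute mult.assoc)
qed

lemma integrable_exp_mult:
  assumes "0 < \<kappa>" "square_integrable f"
  shows "integrable halfline (\<lambda>y. exp (- \<kappa> * y) * cmod (f y))"
  using Bochner_Integration.integrable_norm[OF integrable_mult_square_integrable[OF square_integrable_exp[OF assms(1)] assms(2)]]
  by (simp add: norm_mult)

lemma fwd_op_0: "fwd_op \<kappa> f 0 = 0"
proof -
  have "AE y in halfline. of_real (fwd \<kappa> 0 y) * f y = 0"
    using AE_halfline_nonneg AE_halfline_neq[of 0] by eventually_elim (simp add: fwd_def)
  then show ?thesis unfolding kernel_op_def by (simp add: integral_eq_zero_AE)
qed

text \<open>Dominated convergence; along a convergent sequence in \<open>x\<close> the bound yields one dominating function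
  \<open>exp (\<kappa>K) exp (-\<kappa>y) |f(y)|\<close>. Discontinuity of the kernel on the diagonal is harmless, as it only
  concerns the single point \<open>y = x\<close>.\<close>

lemma continuous_on_kernel_op:
  assumes k: "schur_kernel k M" and f: "square_integrable f" and \<kappa>: "0 < \<kappa>"
    and cont: "\<And>x y. x \<noteq> y \<Longrightarrow> isCont (\<lambda>x. k x y) x"
    and bound: "\<And>x y. 0 \<le> x \<Longrightarrow> 0 \<le> y \<Longrightarrow> k x y \<le> exp (\<kappa> * x) * exp (- \<kappa> * y)"
  shows "continuous_on {0..} (kernel_op k f)"
  unfolding continuous_on_sequentially comp_def
proof (intro allI ballI impI)
  interpret schur_kernel k M by fact
  note [measurable] = square_integrable_measurable[OF f]
  fix X x assume x: "x \<in> {0..}" and X: "(\<forall>n. X n \<in> {0..}) \<and> X \<longlonglongrightarrow> (x :: real)"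
  then have "Bseq X" by (auto intro: convergent_imp_Bseq convergentI)
  then obtain K where K: "\<And>n. \<bar>X n\<bar> \<le> K" unfolding Bseq_def real_norm_def by blast
  show "(\<lambda>n. kernel_op k f (X n)) \<longlonglongrightarrow> kernel_op k f x"
    unfolding kernel_op_def
  proof (rule integral_dominated_convergence)
    show "integrable halfline (\<lambda>y. exp (\<kappa> * K) * (exp (- \<kappa> * y) * cmod (f y)))"
      using integrable_exp_mult[OF \<kappa> f] by simp
    show "AE y in halfline. (\<lambda>n. of_real (k (X n) y) * f y) \<longlonglongrightarrow> of_real (k x y) * f y"
      using AE_halfline_neq[of x]
    proof eventually_elim
      case (elim y)
      then show ?case
        using X by (intro tendsto_intros isCont_tendsto_compose[OF cont]) auto
    qed
    show "AE y in halfline. norm (of_real (k (X n) y) * f y) \<le> exp (\<kappa> * K) * (exp (- \<kappa> * y) * cmod (f y))" for n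
      using AE_halfline_nonneg
    proof eventually_elim
      case (elim y)
      have "k (X n) y \<le> exp (\<kappa> * X n) * exp (- \<kappa> * y)"
        using elim X by (intro bound) auto
      also have "\<dots> \<le> exp (\<kappa> * K) * exp (- \<kappa> * y)"
        using K[of n] \<kappa> by (intro mult_right_mono) auto
      finally have "k (X n) y * cmod (f y) \<le> exp (\<kappa> * K) * exp (- \<kappa> * y) * cmod (f y)"
        by (intro mult_right_mono) auto
      then show ?case using nonneg by (simp add: norm_mult mult.assoc)
    qed
  qed measurable
qed

lemma isCont_fwd:
  assumes "x \<noteq> y"
  shows "isCont (\<lambda>x. fwd \<kappa> x y) x" "isCont (fwd \<kappa> x) y"
proof -
  consider "y < x" | "x < y" using assms by linarith
  then have "isCont (\<lambda>x. fwd \<kappa> x y) x \<and> isCont (fwd \<kappa> x) y"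
  proof cases
    case 1
    have "\<forall>\<^sub>F z in nhds x. fwd \<kappa> z y = exp (- \<kappa> * (z - y))"
      "\<forall>\<^sub>F z in nhds y. fwd \<kappa> x z = exp (- \<kappa> * (x - z))"
      using eventually_nhds_in_open[of "{y<..}" x] eventually_nhds_in_open[of "{..<x}" y] 1
      by (auto simp: fwd_def elim: eventually_mono)
    then show ?thesis by (simp add: isCont_cong)
  next
    case 2
    have "\<forall>\<^sub>F z in nhds x. fwd \<kappa> z y = 0" "\<forall>\<^sub>F z in nhds y. fwd \<kappa> x z = 0"
      using eventually_nhds_in_open[of "{..<y}" x] eventually_nhds_in_open[of "{x<..}" y] 2
      by (auto simp: fwd_def elim: eventually_mono)
    then show ?thesis by (simp add: isCont_cong)
  qed
  then show "isCont (\<lambda>x. fwd \<kappa> x y) x" "isCont (fwd \<kappa> x) y" by auto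
qed

lemma continuous_on_fwd_op:
  assumes "square_integrable f" "0 < \<kappa>"
  shows "continuous_on {0..} (fwd_op \<kappa> f)"
proof (rule continuous_on_kernel_op[OF schur_kernel_fwd[OF assms(2)] assms])
  fix x y :: real assume "0 \<le> x" "0 \<le> y"
  then show "fwd \<kappa> x y \<le> exp (\<kappa> * x) * exp (- \<kappa> * y)"
    using assms(2) by (auto simp: fwd_def algebra_simps mult_left_mono simp flip: exp_add)
qed (simp add: isCont_fwd)

lemma continuous_on_bwd_op:
  assumes "square_integrable f" "0 < \<kappa>"
  shows "continuous_on {0..} (bwd_op \<kappa> f)"
proof (rule continuous_on_kernel_op[OF schur_kernel.transpose[OF schur_kernel_fwd[OF assms(2)]] assms])
  fix x y :: real
  show "fwd \<kappa> y x \<le> exp (\<kappa> * x) * exp (- \<kappa> * y)"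
    by (auto simp: fwd_def algebra_simps simp flip: exp_add)
qed (use isCont_fwd in auto)

section \<open>The resolvent of \<open>\<Delta>(A,B)\<close>\<close>

lemma rep_l2_diff: "AE x in halfline. rep_l2 (f - g) x = rep_l2 f x - rep_l2 g x"
  unfolding minus_l2_def by (simp add: rep_abs_l2 square_integrable_diff square_integrable_rep)

lemma rep_l2_scaleR: "AE x in halfline. rep_l2 (r *\<^sub>R f) x = of_real r * rep_l2 f x"
  unfolding scaleR_l2_def by (simp add: rep_abs_l2 square_integrable_cmult square_integrable_rep)

lemma has_weak_derivI:
  assumes uv: "weak_deriv u v" and f: "AE x in halfline. rep_l2 f x = u x" and g: "AE x in halfline. rep_l2 g x = v x"
  shows "has_weak_deriv f g"
  unfolding has_weak_deriv_def
proof (intro allI impI)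
  fix \<phi> assume \<phi>: "test_function \<phi>"
  note test = square_integrable_test_function[OF \<phi>]
  have sq: "square_integrable u" "square_integrable v"
    using uv by (auto simp: weak_deriv_def)
  note meas = integrable_mult_square_integrable[THEN borel_measurable_integrable]
  have "(\<integral>x. rep_l2 f x * of_real (deriv \<phi> x) \<partial>halfline) = (\<integral>x. u x * of_real (deriv \<phi> x) \<partial>halfline)"
    using f by (intro integral_cong_AE meas square_integrable_rep sq test) auto
  also have "\<dots> = - (\<integral>x. v x * of_real (\<phi> x) \<partial>halfline)"
    using uv \<phi> by (simp add: weak_deriv_def)
  also have "(\<integral>x. v x * of_real (\<phi> x) \<partial>halfline) = (\<integral>x. rep_l2 g x * of_real (\<phi> x) \<partial>halfline)"
    using g by (intro integral_cong_AE meas square_integrable_rep sq test) auto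
  finally show "(\<integral>x. rep_l2 f x * of_real (deriv \<phi> x) \<partial>halfline)
    = - (\<integral>x. rep_l2 g x * of_real (\<phi> x) \<partial>halfline)" .
qed

lemma has_traceI:
  assumes "continuous_on {0..} u" "AE x in halfline. rep_l2 f x = u x" "u 0 = c"
  shows "has_trace f c"
  using assms unfolding has_trace_def by blast

text \<open>The square integrable solutions of \<open>\<kappa>\<^sup>2 u - u'' = \<kappa>\<^sup>2 f\<close> on the half-line, parametrized by the
  coefficient \<open>d\<close> of the decaying exponential, and their derivatives.\<close>

definition resolvent_fun :: "real \<Rightarrow> complex \<Rightarrow> (real \<Rightarrow> complex) \<Rightarrow> real \<Rightarrow> complex"
  where "resolvent_fun \<kappa> d f x = of_real (\<kappa> / 2) * (fwd_op \<kappa> f x + bwd_op \<kappa> f x + of_real (exp (- \<kappa> * x)) * d)"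

definition resolvent_fun_deriv :: "real \<Rightarrow> complex \<Rightarrow> (real \<Rightarrow> complex) \<Rightarrow> real \<Rightarrow> complex"
  where "resolvent_fun_deriv \<kappa> d f x = of_real (\<kappa>\<^sup>2 / 2) * (bwd_op \<kappa> f x - fwd_op \<kappa> f x - of_real (exp (- \<kappa> * x)) * d)"

lemma weak_deriv_resolvent_fun:
  assumes "square_integrable f" "0 < \<kappa>"
  shows "weak_deriv (resolvent_fun \<kappa> d f) (resolvent_fun_deriv \<kappa> d f)"
proof -
  have "weak_deriv (resolvent_fun \<kappa> d f) (\<lambda>x. of_real (\<kappa> / 2) * ((f x - of_real \<kappa> * fwd_op \<kappa> f x)
      + (of_real \<kappa> * bwd_op \<kappa> f x - f x) + (- of_real \<kappa> * of_real (exp (- \<kappa> * x))) * d))"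
    unfolding resolvent_fun_def[abs_def]
    by (intro weak_deriv_cmult weak_deriv_add weak_deriv_mult_right weak_deriv_fwd_op weak_deriv_bwd_op
        weak_deriv_exp assms)
  also have "(\<lambda>x. of_real (\<kappa> / 2) * ((f x - of_real \<kappa> * fwd_op \<kappa> f x)
      + (of_real \<kappa> * bwd_op \<kappa> f x - f x) + (- of_real \<kappa> * of_real (exp (- \<kappa> * x))) * d)) = resolvent_fun_deriv \<kappa> d f"
    by (rule ext) (simp add: resolvent_fun_deriv_def field_simps power2_eq_square)
  finally show ?thesis .
qed

lemma weak_deriv_resolvent_fun_deriv:
  assumes "square_integrable f" "0 < \<kappa>"
  shows "weak_deriv (resolvent_fun_deriv \<kappa> d f) (\<lambda>x. of_real (\<kappa>\<^sup>2) * (resolvent_fun \<kappa> d f x - f x))"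
proof -
  have "weak_deriv (resolvent_fun_deriv \<kappa> d f) (\<lambda>x. of_real (\<kappa>\<^sup>2 / 2) * ((of_real \<kappa> * bwd_op \<kappa> f x - f x)
      - (f x - of_real \<kappa> * fwd_op \<kappa> f x) - (- of_real \<kappa> * of_real (exp (- \<kappa> * x))) * d))"
    unfolding resolvent_fun_deriv_def[abs_def]
    by (intro weak_deriv_cmult weak_deriv_diff weak_deriv_mult_right weak_deriv_fwd_op weak_deriv_bwd_op
        weak_deriv_exp assms)
  also have "(\<lambda>x. of_real (\<kappa>\<^sup>2 / 2) * ((of_real \<kappa> * bwd_op \<kappa> f x - f x)
      - (f x - of_real \<kappa> * fwd_op \<kappa> f x) - (- of_real \<kappa> * of_real (exp (- \<kappa> * x))) * d))
      = (\<lambda>x. of_real (\<kappa>\<^sup>2) * (resolvent_fun \<kappa> d f x - f x))"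
    by (rule ext) (simp add: resolvent_fun_def field_simps power2_eq_square)
  finally show ?thesis .
qed

lemma continuous_on_resolvent_fun:
  assumes "square_integrable f" "0 < \<kappa>"
  shows "continuous_on {0..} (resolvent_fun \<kappa> d f)" "continuous_on {0..} (resolvent_fun_deriv \<kappa> d f)"
  unfolding resolvent_fun_def[abs_def] resolvent_fun_deriv_def[abs_def]
  by (intro continuous_intros continuous_on_fwd_op continuous_on_bwd_op assms)+

text \<open>On edge \<open>j\<close> the solution on the line arrives at 0 with the value \<open>\<kappa>/2 c\<^sub>j\<close>, where
  \<open>c\<^sub>j = \<integral> exp (-\<kappa>y) f\<^sub>j(y) dy\<close> is \<open>bwd_op \<kappa> f\<^sub>j 0\<close>. The Cayley transform maps \<open>c\<close> to the vector of coefficients \<open>d\<close> that the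
  boundary condition demands.\<close>

definition amplitude ::
    "real \<Rightarrow> complex^2^2 \<Rightarrow> complex^2^2 \<Rightarrow> (real \<Rightarrow> complex) \<Rightarrow> (real \<Rightarrow> complex) \<Rightarrow> complex^2"
  where "amplitude \<kappa> A B f1 f2 =
    cayley (\<i> * of_real \<kappa>) A B *v vector [bwd_op \<kappa> f1 0, bwd_op \<kappa> f2 0]"

lemma cayley_mult:
  assumes "invertible (A + scale_matrix (\<i> * k) B)"
  shows "(A + scale_matrix (\<i> * k) B) *v (cayley k A B *v c) = - ((A - scale_matrix (\<i> * k) B) *v c)"
proof -
  let ?M = "A + scale_matrix (\<i> * k) B" and ?N = "A - scale_matrix (\<i> * k) B"
  have "?M *v (cayley k A B *v c) = (?M ** (- (matrix_inv ?M ** ?N))) *v c"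
    by (simp only: cayley_def matrix_vector_mul_assoc)
  also have "?M ** (- (matrix_inv ?M ** ?N)) = - (?M ** (matrix_inv ?M ** ?N))"
    by (simp add: vec_eq_iff matrix_matrix_mult_def sum_negf)
  also have "?M ** (matrix_inv ?M ** ?N) = ?N"
    using someI_ex[OF assms[unfolded invertible_def]] by (simp add: matrix_mul_assoc matrix_inv_def)
  also have "(- ?N) *v c = - (?N *v c)"
    by (simp only: vec_eq_iff matrix_vector_mult_def vec_lambda_beta uminus_vec_def mult_minus_left sum_negf) simp
  finally show ?thesis .
qed

lemma DeltaI:
  assumes "has_weak_deriv \<psi>1 \<psi>1'" "has_weak_deriv \<psi>1' \<psi>1''" "has_trace \<psi>1 a1" "has_trace \<psi>1' b1"
    "has_weak_deriv \<psi>2 \<psi>2'" "has_weak_deriv \<psi>2' \<psi>2''" "has_trace \<psi>2 a2" "has_trace \<psi>2' b2"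
    "A *v vector [a1, a2] + B *v vector [b1, b2] = 0"
  shows "((\<psi>1, \<psi>2), (\<psi>1'', \<psi>2'')) \<in> Delta A B"
  unfolding Delta_def using assms by blast

lemma i_times_i_times: "\<i> * (\<i> * z) = - z"
  by (simp flip: mult.assoc)

text \<open>The boundary values are \<open>u(0) = \<kappa>/2 (c + d)\<close> and \<open>u'(0) = \<kappa>\<^sup>2/2 (c - d)\<close>, so that
  \<open>A u(0) + B u'(0) = \<kappa>/2 ((A + \<kappa>B) c + (A - \<kappa>B) d)\<close>, which vanishes for \<open>d = S c\<close>. The product
  \<open>\<i> * (\<i> * \<kappa>)\<close> is \<open>-\<kappa>\<close>, in the form in which it occurs in the Cayley transform.\<close>

lemma resolvent_fun_in_Delta:
  fixes f :: l2x2
  assumes \<kappa>: "0 < \<kappa>" and inv: "invertible (A + scale_matrix (\<i> * (\<i> * of_real \<kappa>)) B)"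
  defines "d \<equiv> amplitude \<kappa> A B (rep_l2 (fst f)) (rep_l2 (snd f))"
  defines "u \<equiv> (abs_l2 (resolvent_fun \<kappa> (d $ 1) (rep_l2 (fst f))), abs_l2 (resolvent_fun \<kappa> (d $ 2) (rep_l2 (snd f))))"
  shows "(u, \<kappa>\<^sup>2 *\<^sub>R (u - f)) \<in> Delta A B"
proof -
  have 1: "has_weak_deriv (abs_l2 (resolvent_fun \<kappa> e (rep_l2 g))) (abs_l2 (resolvent_fun_deriv \<kappa> e (rep_l2 g)))"
    "has_weak_deriv (abs_l2 (resolvent_fun_deriv \<kappa> e (rep_l2 g))) (\<kappa>\<^sup>2 *\<^sub>R (abs_l2 (resolvent_fun \<kappa> e (rep_l2 g)) - g))"
    "has_trace (abs_l2 (resolvent_fun \<kappa> e (rep_l2 g))) (of_real (\<kappa> / 2) * (bwd_op \<kappa> (rep_l2 g) 0 + e))"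
    "has_trace (abs_l2 (resolvent_fun_deriv \<kappa> e (rep_l2 g))) (of_real (\<kappa>\<^sup>2 / 2) * (bwd_op \<kappa> (rep_l2 g) 0 - e))"
    for e and g :: l2
  proof -
    let ?G = "rep_l2 g"
    note g = square_integrable_rep[of g]
    note w = weak_deriv_resolvent_fun[OF g \<kappa>, of e] and w' = weak_deriv_resolvent_fun_deriv[OF g \<kappa>, of e]
    have u: "AE x in halfline. rep_l2 (abs_l2 (resolvent_fun \<kappa> e ?G)) x = resolvent_fun \<kappa> e ?G x"
      using w by (intro rep_abs_l2) (simp add: weak_deriv_def)
    have u': "AE x in halfline. rep_l2 (abs_l2 (resolvent_fun_deriv \<kappa> e ?G)) x = resolvent_fun_deriv \<kappa> e ?G x"
      using w' by (intro rep_abs_l2) (simp add: weak_deriv_def)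
    have u'': "AE x in halfline. rep_l2 (\<kappa>\<^sup>2 *\<^sub>R (abs_l2 (resolvent_fun \<kappa> e ?G) - g)) x
      = of_real (\<kappa>\<^sup>2) * (resolvent_fun \<kappa> e ?G x - ?G x)"
      using u rep_l2_scaleR[of "\<kappa>\<^sup>2" "abs_l2 (resolvent_fun \<kappa> e ?G) - g"] rep_l2_diff[of "abs_l2 (resolvent_fun \<kappa> e ?G)" g]
      by eventually_elim simp
    show "has_weak_deriv (abs_l2 (resolvent_fun \<kappa> e ?G)) (abs_l2 (resolvent_fun_deriv \<kappa> e ?G))"
      by (rule has_weak_derivI[OF w u u'])
    show "has_weak_deriv (abs_l2 (resolvent_fun_deriv \<kappa> e ?G)) (\<kappa>\<^sup>2 *\<^sub>R (abs_l2 (resolvent_fun \<kappa> e ?G) - g))"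
      by (rule has_weak_derivI[OF w' u' u''])
    show "has_trace (abs_l2 (resolvent_fun \<kappa> e ?G)) (of_real (\<kappa> / 2) * (bwd_op \<kappa> ?G 0 + e))"
      by (rule has_traceI[OF continuous_on_resolvent_fun(1)[OF g \<kappa>] u]) (simp add: resolvent_fun_def fwd_op_0)
    show "has_trace (abs_l2 (resolvent_fun_deriv \<kappa> e ?G)) (of_real (\<kappa>\<^sup>2 / 2) * (bwd_op \<kappa> ?G 0 - e))"
      by (rule has_traceI[OF continuous_on_resolvent_fun(2)[OF g \<kappa>] u']) (simp add: resolvent_fun_deriv_def fwd_op_0)
  qed
  define c where "c = (vector [bwd_op \<kappa> (rep_l2 (fst f)) 0, bwd_op \<kappa> (rep_l2 (snd f)) 0] :: complex^2)"
  (* The definition of the Cayley transform is the equation (A - \<kappa> B) d = - (A + \<kappa> B) c. *)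
  have "A *v vector [of_real (\<kappa> / 2) * (c $ 1 + d $ 1), of_real (\<kappa> / 2) * (c $ 2 + d $ 2)]
    + B *v vector [of_real (\<kappa>\<^sup>2 / 2) * (c $ 1 - d $ 1), of_real (\<kappa>\<^sup>2 / 2) * (c $ 2 - d $ 2)]
    = (of_real (\<kappa> / 2)) *s (((A + scale_matrix (\<i> * (\<i> * of_real \<kappa>)) B) *v d
      + (A - scale_matrix (\<i> * (\<i> * of_real \<kappa>)) B) *v c))"
    unfolding vec_eq_iff i_times_i_times
    by (simp add: matrix_vector_mult_def sum_2 scale_matrix_def map_matrix_def field_simps power2_eq_square)
  also have "\<dots> = 0"
    using cayley_mult[OF inv, of c] by (simp add: d_def amplitude_def c_def)
  finally have bc: "A *v vector [of_real (\<kappa> / 2) * (c $ 1 + d $ 1), of_real (\<kappa> / 2) * (c $ 2 + d $ 2)]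
    + B *v vector [of_real (\<kappa>\<^sup>2 / 2) * (c $ 1 - d $ 1), of_real (\<kappa>\<^sup>2 / 2) * (c $ 2 - d $ 2)] = 0" .
  have c: "c $ 1 = bwd_op \<kappa> (rep_l2 (fst f)) 0" "c $ 2 = bwd_op \<kappa> (rep_l2 (snd f)) 0"
    by (simp_all add: c_def)
  show ?thesis
    using DeltaI[OF 1(1-4)[of "d $ 1" "fst f"] 1(1-4)[of "d $ 2" "snd f"]] bc
    unfolding c by (cases f) (simp add: u_def)
qed

text \<open>A vector in the kernel of \<open>A - \<kappa>B\<close> gives an eigenfunction of \<open>\<Delta>(A,B)\<close> with eigenvalue
  \<open>\<kappa>\<^sup>2\<close>. As the generator of a contraction semigroup has no positive eigenvalue, \<open>A - \<kappa>B\<close> is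
  invertible and the Cayley transform is meaningful.\<close>

lemma exp_in_Delta:
  fixes a :: "complex^2"
  assumes \<kappa>: "0 < \<kappa>" and a: "(A + scale_matrix (\<i> * (\<i> * of_real \<kappa>)) B) *v a = 0"
  defines "e \<equiv> \<lambda>i x. of_real (exp (- \<kappa> * x)) * a $ i"
  defines "u \<equiv> (abs_l2 (e 1), abs_l2 (e 2))"
  shows "(u, \<kappa>\<^sup>2 *\<^sub>R u) \<in> Delta A B"
proof -
  define e' where "e' i x = - of_real \<kappa> * e i x" for i x
  have w: "weak_deriv (e i) (e' i)" for i
  proof -
    have "weak_deriv (e i) (\<lambda>x. - of_real \<kappa> * of_real (exp (- \<kappa> * x)) * a $ i)"
      unfolding e_def by (intro weak_deriv_mult_right weak_deriv_exp \<kappa>)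
    then show ?thesis by (simp add: e'_def[abs_def] e_def mult.assoc)
  qed
  have w': "weak_deriv (e' i) (\<lambda>x. of_real (\<kappa>\<^sup>2) * e i x)" for i
    using weak_deriv_cmult[OF w[of i], of "- of_real \<kappa>"]
    by (simp add: e'_def[abs_def] power2_eq_square mult.assoc)
  have r: "AE x in halfline. rep_l2 (abs_l2 (e i)) x = e i x"
    "AE x in halfline. rep_l2 (abs_l2 (e' i)) x = e' i x" for i
    using w[of i] by (auto intro!: rep_abs_l2 simp: weak_deriv_def)
  have r': "AE x in halfline. rep_l2 (\<kappa>\<^sup>2 *\<^sub>R abs_l2 (e i)) x = of_real (\<kappa>\<^sup>2) * e i x" for i
    using r(1)[of i] rep_l2_scaleR[of "\<kappa>\<^sup>2" "abs_l2 (e i)"] by eventually_elim simp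
  have d: "has_weak_deriv (abs_l2 (e i)) (abs_l2 (e' i))"
    "has_weak_deriv (abs_l2 (e' i)) (\<kappa>\<^sup>2 *\<^sub>R abs_l2 (e i))" for i
    by (rule has_weak_derivI[OF w r] has_weak_derivI[OF w' r(2) r'])+
  have t: "has_trace (abs_l2 (e i)) (a $ i)" "has_trace (abs_l2 (e' i)) (- of_real \<kappa> * a $ i)" for i
    by (rule has_traceI[OF _ r(1)] has_traceI[OF _ r(2)];
        auto simp: e_def e'_def intro!: continuous_intros)+
  have bc: "A *v vector [a $ 1, a $ 2] + B *v vector [- of_real \<kappa> * a $ 1, - of_real \<kappa> * a $ 2] = 0"
    using a unfolding vec_eq_iff i_times_i_times
    by (simp add: matrix_vector_mult_def sum_2 scale_matrix_def map_matrix_def algebra_simps)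
  show ?thesis
    using DeltaI[OF d[of 1] t[of 1] d[of 2] t[of 2] bc] by (simp add: u_def)
qed

lemma exp_eq_0D:
  assumes "0 < \<kappa>" "abs_l2 (\<lambda>x. of_real (exp (- \<kappa> * x)) * a) = 0"
  shows "a = 0"
proof -
  have "weak_deriv (\<lambda>x. of_real (exp (- \<kappa> * x)) * a) (\<lambda>x. - of_real \<kappa> * of_real (exp (- \<kappa> * x)) * a)"
    by (intro weak_deriv_mult_right weak_deriv_exp assms)
  then have "square_integrable (\<lambda>x. of_real (exp (- \<kappa> * x)) * a)"
    by (simp add: weak_deriv_def)
  then have "AE x in halfline. rep_l2 0 x = of_real (exp (- \<kappa> * x)) * a"
    using rep_abs_l2 assms(2) by fastforce
  moreover have "AE x in halfline. rep_l2 0 x = 0"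
    unfolding zero_l2_def by (rule rep_abs_l2[OF square_integrable_zero])
  ultimately have "AE x in halfline. a = 0" by eventually_elim simp
  then show ?thesis by (rule AE_halfline_const)
qed

lemma contraction_semigroup_l2x2:
  assumes "C0_semigroup T" "contractive T"
  shows "contraction_semigroup T"
proof (rule contraction_semigroup.intro)
  note T = assms[unfolded C0_semigroup_def contractive_def]
  show "bounded_linear (T t)" if "0 \<le> t" for t using T(1) that by blast
  show "T 0 f = f" for f using T(1) by blast
  show "T (s + t) f = T s (T t f)" if "0 \<le> s" "0 \<le> t" for s t f using T(1) that by blast
  show "((\<lambda>t. T t f) \<longlongrightarrow> f) (at_right 0)" for f using T(1) by blast
  show "norm (T t f) \<le> norm f" if "0 \<le> t" for t f using T(2) that by blast
qed

lemma invertible_boundary_matrix: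
  assumes "C0_semigroup T" "contractive T" and gen: "generator T = Delta A B" and \<kappa>: "0 < \<kappa>"
  shows "invertible (A + scale_matrix (\<i> * (\<i> * of_real \<kappa>)) B)"
proof -
  interpret contraction_semigroup T by (rule contraction_semigroup_l2x2[OF assms(1,2)])
  have "a = 0" if a: "(A + scale_matrix (\<i> * (\<i> * of_real \<kappa>)) B) *v a = 0" for a
  proof -
    define u where "u = (abs_l2 (\<lambda>x. of_real (exp (- \<kappa> * x)) * a $ 1), abs_l2 (\<lambda>x. of_real (exp (- \<kappa> * x)) * a $ 2))"
    have "(u, \<kappa>\<^sup>2 *\<^sub>R u) \<in> generator T"
      using exp_in_Delta[OF \<kappa> a] gen by (simp add: u_def)
    then have "local.gen u (\<kappa>\<^sup>2 *\<^sub>R u)"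
      by (simp add: gen_def generator_def)
    from dissipative[OF this, of "1 / \<kappa>\<^sup>2"] have "u = 0" using \<kappa> by simp
    then have "a $ 1 = 0" "a $ 2 = 0"
      using exp_eq_0D[OF \<kappa>, of "a $ 1"] exp_eq_0D[OF \<kappa>, of "a $ 2"]
      by (simp_all only: u_def zero_prod_def prod.inject)
    then show ?thesis by (simp add: vec_eq_iff forall_2)
  qed
  then show ?thesis
    unfolding invertible_left_inverse matrix_left_invertible_ker by blast
qed

section \<open>From the resolvent kernel to the semigroup\<close>

lemma closed_induced_set:
  assumes C: "closed C"
  shows "closed (induced_set C)"
  unfolding closed_sequential_limits
proof (intro allI impI, elim conjE)
  fix F :: "nat \<Rightarrow> l2x2" and f assume F: "\<forall>n. F n \<in> induced_set C" and lim: "F \<longlonglongrightarrow> f"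
  define X where "X n x = (cmod (rep_l2 (fst (F n - f)) x))\<^sup>2 + (cmod (rep_l2 (snd (F n - f)) x))\<^sup>2" for n x
  have int: "integrable halfline (\<lambda>x. (cmod (rep_l2 g x))\<^sup>2)" for g
    using square_integrable_rep[of g] by (simp add: square_integrable_def)
  have "(\<integral>x. norm (X n x) \<partial>halfline) = (norm (F n - f))\<^sup>2" for n
  proof -
    have "(norm g)\<^sup>2 = (\<integral>x. (cmod (rep_l2 g x))\<^sup>2 \<partial>halfline)" for g
      by (simp add: norm_l2)
    moreover have "norm (X n x) = X n x" for x by (simp add: X_def)
    moreover have "(\<integral>x. X n x \<partial>halfline) = (\<integral>x. (cmod (rep_l2 (fst (F n - f)) x))\<^sup>2 \<partial>halfline)
      + (\<integral>x. (cmod (rep_l2 (snd (F n - f)) x))\<^sup>2 \<partial>halfline)"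
      unfolding X_def by (rule Bochner_Integration.integral_add[OF int int])
    moreover have "(norm (F n - f))\<^sup>2 = (norm (fst (F n - f)))\<^sup>2 + (norm (snd (F n - f)))\<^sup>2"
      unfolding norm_prod_def by (rule real_sqrt_pow2) simp
    ultimately show ?thesis by simp
  qed
  moreover have "(\<lambda>n. (norm (F n - f))\<^sup>2) \<longlonglongrightarrow> 0\<^sup>2"
    using lim by (intro tendsto_intros tendsto_norm_zero LIM_zero)
  ultimately have "(\<lambda>n. \<integral>x. norm (X n x) \<partial>halfline) \<longlonglongrightarrow> 0" by simp
  moreover have "integrable halfline (X n)" for n
    unfolding X_def[abs_def] using int by simp
  ultimately have "\<exists>r :: nat \<Rightarrow> nat. strict_mono r \<and> (AE x in halfline. (\<lambda>n. X (r n) x) \<longlonglongrightarrow> 0)"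
    by (intro tendsto_L1_AE_subseq)
  then obtain r where r: "AE x in halfline. (\<lambda>n. X (r n) x) \<longlonglongrightarrow> 0"
    by blast
  have F_in: "AE x in halfline. \<forall>n. vector [rep_l2 (fst (F n)) x, rep_l2 (snd (F n)) x] \<in> C"
    using F by (simp add: AE_all_countable induced_set_def)
  have diff: "AE x in halfline. \<forall>n. rep_l2 (fst (F n - f)) x = rep_l2 (fst (F n)) x - rep_l2 (fst f) x"
    "AE x in halfline. \<forall>n. rep_l2 (snd (F n - f)) x = rep_l2 (snd (F n)) x - rep_l2 (snd f) x"
    by (simp_all add: AE_all_countable rep_l2_diff)
  have "AE x in halfline. vector [rep_l2 (fst f) x, rep_l2 (snd f) x] \<in> C"
    using r F_in diff
  proof eventually_elim
    case (elim x)
    have *: "(\<lambda>n. u (r n)) \<longlonglongrightarrow> l" if "\<And>n. (cmod (u n - l))\<^sup>2 \<le> X n x" for u l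
    proof -
      have "(\<lambda>n. (cmod (u (r n) - l))\<^sup>2) \<longlonglongrightarrow> 0"
        by (rule tendsto_sandwich[OF _ _ tendsto_const elim(1)]) (use that in auto)
      then have "(\<lambda>n. sqrt ((cmod (u (r n) - l))\<^sup>2)) \<longlonglongrightarrow> sqrt 0" by (rule tendsto_real_sqrt)
      then have "(\<lambda>n. cmod (u (r n) - l)) \<longlonglongrightarrow> 0" by simp
      then show ?thesis by (rule LIM_zero_cancel[OF tendsto_norm_zero_cancel])
    qed
    have lim: "(\<lambda>n. rep_l2 (fst (F (r n))) x) \<longlonglongrightarrow> rep_l2 (fst f) x"
      "(\<lambda>n. rep_l2 (snd (F (r n))) x) \<longlonglongrightarrow> rep_l2 (snd f) x"
      by (rule *, simp only: X_def elim(3) elim(4), simp)+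
    have "(\<lambda>n. vector [rep_l2 (fst (F (r n))) x, rep_l2 (snd (F (r n))) x] :: complex^2)
      \<longlonglongrightarrow> vector [rep_l2 (fst f) x, rep_l2 (snd f) x]"
    proof (rule vec_tendstoI)
      fix i :: 2
      show "(\<lambda>n. (vector [rep_l2 (fst (F (r n))) x, rep_l2 (snd (F (r n))) x] :: complex^2) $ i)
        \<longlonglongrightarrow> vector [rep_l2 (fst f) x, rep_l2 (snd f) x] $ i"
        using lim exhaust_2[of i] by auto
    qed
    then show ?case
      by (rule closed_sequentially[OF C elim(2)[rule_format]])
  qed
  then show "f \<in> induced_set C" by (simp add: induced_set_def)
qed

lemma AE_exp_abs_eq: "AE y in halfline. exp (- \<kappa> * \<bar>x - y\<bar>) = fwd \<kappa> x y + fwd \<kappa> y x"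
  using AE_halfline_neq[of x] by eventually_elim (auto simp: fwd_def abs_if)

lemma exp_add_eq: "0 \<le> y \<Longrightarrow> exp (- \<kappa> * (x + y)) = exp (- \<kappa> * x) * fwd \<kappa> y 0"
  by (simp add: fwd_def distrib_left flip: exp_add)

text \<open>The resolvent as an integral operator. Row \<open>i\<close> of the kernel is obtained with \<open>f = f\<^sub>i\<close> and with
  the entries \<open>s1\<close>, \<open>s2\<close> of row \<open>i\<close> of the Cayley transform.\<close>

lemma has_bochner_integral_resolvent_fun:
  assumes \<kappa>: "0 < \<kappa>" and x: "0 \<le> x" and f: "square_integrable f" "square_integrable f1" "square_integrable f2"
  shows "has_bochner_integral halfline (\<lambda>y. of_real (\<kappa> / 2) * (of_real (exp (- \<kappa> * \<bar>x - y\<bar>)) * f y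
    + of_real (exp (- \<kappa> * (x + y))) * (s1 * f1 y + s2 * f2 y)))
    (resolvent_fun \<kappa> (s1 * bwd_op \<kappa> f1 0 + s2 * bwd_op \<kappa> f2 0) f x)"
proof -
  interpret fwd: schur_kernel "fwd \<kappa>" "1 / \<kappa>" by (rule schur_kernel_fwd[OF \<kappa>])
  interpret bwd: schur_kernel "\<lambda>x y. fwd \<kappa> y x" "1 / \<kappa>" by (rule fwd.transpose)
  note [measurable] = f[THEN square_integrable_measurable]
  have i: "has_bochner_integral halfline (\<lambda>y. of_real (fwd \<kappa> x y) * f y) (fwd_op \<kappa> f x)"
    "has_bochner_integral halfline (\<lambda>y. of_real (fwd \<kappa> y x) * f y) (bwd_op \<kappa> f x)"
    unfolding kernel_op_def using f x
    by (simp_all add: has_bochner_integral_integrable fwd.integrable_kernel bwd.integrable_kernel)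
  have j: "has_bochner_integral halfline (\<lambda>y. of_real (fwd \<kappa> y 0) * g y) (bwd_op \<kappa> g 0)"
    if "square_integrable g" for g
    unfolding kernel_op_def using that
    by (simp add: has_bochner_integral_integrable bwd.integrable_kernel)
  have "has_bochner_integral halfline (\<lambda>y. of_real (\<kappa> / 2) * (of_real (fwd \<kappa> x y) * f y + of_real (fwd \<kappa> y x) * f y
     + of_real (exp (- \<kappa> * x)) * (s1 * (of_real (fwd \<kappa> y 0) * f1 y) + s2 * (of_real (fwd \<kappa> y 0) * f2 y))))
     (resolvent_fun \<kappa> (s1 * bwd_op \<kappa> f1 0 + s2 * bwd_op \<kappa> f2 0) f x)"
    unfolding resolvent_fun_def
    by (intro has_bochner_integral_mult_right has_bochner_integral_add i j f)
  then show ?thesis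
  proof (rule has_bochner_integralI_AE)
    show "AE y in halfline. of_real (\<kappa> / 2) * (of_real (fwd \<kappa> x y) * f y + of_real (fwd \<kappa> y x) * f y
     + of_real (exp (- \<kappa> * x)) * (s1 * (of_real (fwd \<kappa> y 0) * f1 y) + s2 * (of_real (fwd \<kappa> y 0) * f2 y)))
     = of_real (\<kappa> / 2) * (of_real (exp (- \<kappa> * \<bar>x - y\<bar>)) * f y
      + of_real (exp (- \<kappa> * (x + y))) * (s1 * f1 y + s2 * f2 y))"
      using AE_exp_abs_eq[of \<kappa> x] AE_halfline_nonneg
    proof eventually_elim
      case (elim y)
      show ?case unfolding elim(1) exp_add_eq[OF elim(2)] by (simp add: algebra_simps)
    qed
  qed measurable
qed

text \<open>The mass \<open>exp (-\<kappa>x)/2\<close> that the kernel on the line has on the negative half-line is exactly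
  replaced by the mass of the reflected kernel.\<close>

lemma has_bochner_integral_total_mass:
  assumes \<kappa>: "0 < \<kappa>" and x: "0 \<le> x"
  shows "has_bochner_integral halfline (\<lambda>y. \<kappa> / 2 * (exp (- \<kappa> * \<bar>x - y\<bar>) + exp (- \<kappa> * (x + y)))) 1"
proof -
  have "has_bochner_integral halfline (\<lambda>y. \<kappa> / 2 * (fwd \<kappa> x y + fwd \<kappa> y x + exp (- \<kappa> * x) * fwd \<kappa> y 0))
    (\<kappa> / 2 * ((1 - exp (- \<kappa> * x)) / \<kappa> + 1 / \<kappa> + exp (- \<kappa> * x) * (1 / \<kappa>)))"
    by (intro has_bochner_integral_mult_right has_bochner_integral_add
        has_bochner_integral_fwd_1 has_bochner_integral_fwd_2 \<kappa> x order_refl)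
  also have "\<kappa> / 2 * ((1 - exp (- \<kappa> * x)) / \<kappa> + 1 / \<kappa> + exp (- \<kappa> * x) * (1 / \<kappa>)) = 1"
    using \<kappa> by (simp add: field_simps)
  finally show ?thesis
  proof (rule has_bochner_integralI_AE)
    show "AE y in halfline. \<kappa> / 2 * (fwd \<kappa> x y + fwd \<kappa> y x + exp (- \<kappa> * x) * fwd \<kappa> y 0)
      = \<kappa> / 2 * (exp (- \<kappa> * \<bar>x - y\<bar>) + exp (- \<kappa> * (x + y)))"
      using AE_exp_abs_eq[of \<kappa> x] AE_halfline_nonneg
    proof eventually_elim
      case (elim y)
      show ?case unfolding elim(1) exp_add_eq[OF elim(2)] ..
    qed
  qed measurable
qed

text \<open>Invariance under the resolvent is assumed for representatives and at each point, which keeps null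
  sets of \<open>x\<close> out of the applications. With \<open>h = 1/\<kappa>\<^sup>2\<close>
  the operator \<open>\<kappa>\<^sup>2 (\<kappa>\<^sup>2 - \<Delta>(A,B))\<inverse>\<close> is the operator \<open>J h\<close> of the exponential formula.\<close>

lemma semigroup_invariant_induced_set:
  fixes T :: "real \<Rightarrow> l2x2 \<Rightarrow> l2x2"
  assumes C0: "C0_semigroup T" and contr: "contractive T" and gen: "generator T = Delta A B"
    and C: "closed C"
    and inv: "\<And>\<kappa> f1 f2 x. 0 < \<kappa> \<Longrightarrow> 0 \<le> x \<Longrightarrow> square_integrable f1 \<Longrightarrow> square_integrable f2 \<Longrightarrow>
      AE y in halfline. vector [f1 y, f2 y] \<in> C \<Longrightarrow>
      vector [resolvent_fun \<kappa> (amplitude \<kappa> A B f1 f2 $ 1) f1 x, resolvent_fun \<kappa> (amplitude \<kappa> A B f1 f2 $ 2) f2 x] \<in> C"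
    and f: "f \<in> induced_set C" and t: "0 \<le> t"
  shows "T t f \<in> induced_set C"
proof -
  interpret contraction_semigroup T by (rule contraction_semigroup_l2x2[OF C0 contr])
  define R where "R \<kappa> f =
    (let d = amplitude \<kappa> A B (rep_l2 (fst f)) (rep_l2 (snd f))
     in (abs_l2 (resolvent_fun \<kappa> (d $ 1) (rep_l2 (fst f))), abs_l2 (resolvent_fun \<kappa> (d $ 2) (rep_l2 (snd f)))))"
    for \<kappa> and f :: l2x2
  have R: "local.gen (R \<kappa> f) (\<kappa>\<^sup>2 *\<^sub>R (R \<kappa> f - f))" if "0 < \<kappa>" for \<kappa> f
    using resolvent_fun_in_Delta[OF that invertible_boundary_matrix[OF C0 contr gen that], of f] gen
    unfolding gen_def R_def Let_def generator_def by blast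
  have R': "local.gen (R (1 / sqrt h) f) ((R (1 / sqrt h) f - f) /\<^sub>R h)" if "0 < h" for h f
    using R[of "1 / sqrt h" f] that by (simp only: power_divide) (simp add: inverse_eq_divide)
  interpret contraction_semigroup_resolvent T
    by (rule contraction_semigroup_resolvent.intro[OF contraction_semigroup_axioms
          contraction_semigroup_resolvent_axioms.intro]) (blast intro: R')
  show ?thesis
  proof (rule invariant_if_resolvent_invariant[OF closed_induced_set[OF C] _ f t])
    fix h :: real and f assume h: "0 < h" and f: "f \<in> induced_set C"
    define \<kappa> where "\<kappa> = 1 / sqrt h"
    have \<kappa>: "0 < \<kappa>" using h by (simp add: \<kappa>_def)
    have "J h f = R \<kappa> f" unfolding \<kappa>_def by (rule J_eqI[OF h R'[OF h]])
    moreover have "R \<kappa> f \<in> induced_set C"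
    proof -
      have AE_rep: "AE x in halfline. rep_l2 (abs_l2 (resolvent_fun \<kappa> d (rep_l2 g))) x = resolvent_fun \<kappa> d (rep_l2 g) x"
        for d g
        using weak_deriv_resolvent_fun[OF square_integrable_rep[of g] \<kappa>, of d]
        by (intro rep_abs_l2) (simp add: weak_deriv_def)
      have "AE y in halfline. vector [rep_l2 (fst f) y, rep_l2 (snd f) y] \<in> C"
        using f by (simp add: induced_set_def)
      note * = inv[OF \<kappa> _ square_integrable_rep square_integrable_rep this]
      show ?thesis
        unfolding induced_set_def mem_Collect_eq R_def Let_def fst_conv snd_conv
        using AE_rep[of "amplitude \<kappa> A B (rep_l2 (fst f)) (rep_l2 (snd f)) $ 1" "fst f"]
          AE_rep[of "amplitude \<kappa> A B (rep_l2 (fst f)) (rep_l2 (snd f)) $ 2" "snd f"] AE_halfline_nonneg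
      proof eventually_elim
        case (elim x)
        show ?case unfolding elim(1,2) by (rule *[OF elim(3)])
      qed
    qed
    ultimately show "J h f \<in> induced_set C" by simp
  qed
qed

section \<open>Invariant cones and the sup norm\<close>

lemma kernel_matrix_mult:
  fixes \<xi> :: "complex^2"
  assumes "S = cayley (\<i> * of_real \<kappa>) A B"
  shows "kernel_matrix \<kappa> x1 x2 y1 y2 A B *v \<xi> = vector
     [of_real (\<kappa> / 2) * (of_real (exp (- \<kappa> * \<bar>x1 - y1\<bar>)) * \<xi> $ 1
        + (of_real (exp (- \<kappa> * (x1 + y1))) * (S $ 1 $ 1 * \<xi> $ 1) + of_real (exp (- \<kappa> * (x1 + y2))) * (S $ 1 $ 2 * \<xi> $ 2))),
      of_real (\<kappa> / 2) * (of_real (exp (- \<kappa> * \<bar>x2 - y2\<bar>)) * \<xi> $ 2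
        + (of_real (exp (- \<kappa> * (x2 + y1))) * (S $ 2 $ 1 * \<xi> $ 1) + of_real (exp (- \<kappa> * (x2 + y2))) * (S $ 2 $ 2 * \<xi> $ 2)))]"
  unfolding vec_eq_iff forall_2
  by (simp add: kernel_matrix_def matrix_vector_mult_def sum_2 scale_matrix_def map_matrix_def
      distrib_left distrib_right mult.assoc flip: assms)

text \<open>With all four points equal to \<open>s\<close> the matrix tends to \<open>\<kappa>/2\<close> times the identity for
  \<open>s \<rightarrow> \<infinity>\<close>; choose \<open>\<kappa> = 2r\<close>.\<close>

lemma scaleR_mem_if_kernel_invariant:
  assumes C: "closed C"
    and inv: "\<And>\<kappa> x1 x2 y1 y2. 0 < \<kappa> \<Longrightarrow> 0 \<le> x1 \<Longrightarrow> 0 \<le> x2 \<Longrightarrow> 0 \<le> y1 \<Longrightarrow> 0 \<le> y2 \<Longrightarrow>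
      leaves_invariant ((*v) (kernel_matrix \<kappa> x1 x2 y1 y2 A B)) C"
    and \<xi>: "\<xi> \<in> C" and r: "0 < r"
  shows "r *\<^sub>R \<xi> \<in> C"
proof (rule Lim_in_closed_set[OF C])
  let ?K = "\<lambda>s. kernel_matrix (2 * r) s s s s A B *v \<xi>"
  define S where "S = cayley (\<i> * of_real (2 * r)) A B"
  show "\<forall>\<^sub>F s in at_top. ?K s \<in> C"
    using eventually_ge_at_top[of "0 :: real"]
  proof eventually_elim
    case (elim s)
    with inv[of "2 * r" s s s s] \<xi> r show ?case by (auto simp: leaves_invariant_def)
  qed
  show "(?K \<longlongrightarrow> r *\<^sub>R \<xi>) at_top"
  proof (rule vec_tendstoI)
    fix i :: 2
    have "((\<lambda>s. exp (- (2 * r) * (s + s))) \<longlongrightarrow> 0) at_top" using r by real_asymp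
    from tendsto_of_real[OF this] have *: "((\<lambda>s. complex_of_real (exp (- (2 * r) * (s + s)))) \<longlongrightarrow> 0) at_top" by simp
    have lim: "((\<lambda>s. of_real (2 * r / 2) * (of_real (exp (- (2 * r) * \<bar>s - s\<bar>)) * z
      + (of_real (exp (- (2 * r) * (s + s))) * a + of_real (exp (- (2 * r) * (s + s))) * b)))
      \<longlongrightarrow> of_real (2 * r / 2) * (of_real (exp (- (2 * r) * 0)) * z + (0 * a + 0 * b))) at_top" for z a b :: complex
      by (intro tendsto_intros *) simp
    from lim[of "\<xi> $ 1" "S $ 1 $ 1 * \<xi> $ 1" "S $ 1 $ 2 * \<xi> $ 2"]
    have 1: "((\<lambda>s. ?K s $ 1) \<longlongrightarrow> (r *\<^sub>R \<xi>) $ 1) at_top"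
      unfolding kernel_matrix_mult[OF S_def] vector_2 by (simp add: scaleR_conv_of_real[where 'a = complex])
    from lim[of "\<xi> $ 2" "S $ 2 $ 1 * \<xi> $ 1" "S $ 2 $ 2 * \<xi> $ 2"]
    have 2: "((\<lambda>s. ?K s $ 2) \<longlongrightarrow> (r *\<^sub>R \<xi>) $ 2) at_top"
      unfolding kernel_matrix_mult[OF S_def] vector_2 by (simp add: scaleR_conv_of_real[where 'a = complex])
    show "((\<lambda>s. ?K s $ i) \<longlongrightarrow> (r *\<^sub>R \<xi>) $ i) at_top"
      using 1 2 exhaust_2[of i] by auto
  qed
qed simp

text \<open>If the integral were outside of \<open>C\<close>, a linear functional would separate it from \<open>C\<close>. On a cone, a
  functional that is bounded below is nonnegative, and then so is its value at the integral.\<close>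

lemma integral_mem_closed_convex_cone:
  fixes C :: "(complex^2) set"
  assumes C: "closed C" "convex C" and cone: "\<And>r \<xi>. 0 < r \<Longrightarrow> \<xi> \<in> C \<Longrightarrow> r *\<^sub>R \<xi> \<in> C" and "C \<noteq> {}"
    and g: "has_bochner_integral M g1 z1" "has_bochner_integral M g2 z2"
    and mem: "AE y in M. vector [g1 y, g2 y] \<in> C"
  shows "vector [z1, z2] \<in> C"
proof (rule ccontr)
  assume "vector [z1, z2] \<notin> C"
  then obtain a b where ab: "a \<bullet> vector [z1, z2] < b" "\<And>\<xi>. \<xi> \<in> C \<Longrightarrow> b < a \<bullet> \<xi>"
    using separating_hyperplane_closed_point[OF C(2,1)] by blast
  from \<open>C \<noteq> {}\<close> obtain \<xi>0 where \<xi>0: "\<xi>0 \<in> C" by blast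
  have "(\<lambda>n. (1 / real (Suc n)) *\<^sub>R \<xi>0) \<longlonglongrightarrow> 0 *\<^sub>R \<xi>0"
    by (intro tendsto_intros LIMSEQ_Suc[OF lim_1_over_n])
  then have "0 \<in> C"
    using closed_sequentially[OF C(1), of "\<lambda>n. (1 / real (Suc n)) *\<^sub>R \<xi>0"] cone[OF _ \<xi>0] by simp
  with ab(2)[of 0] have b: "b < 0" by simp
  have nonneg: "0 \<le> a \<bullet> \<xi>" if "\<xi> \<in> C" for \<xi>
  proof (rule ccontr)
    assume neg: "\<not> 0 \<le> a \<bullet> \<xi>"
    have "(b / (a \<bullet> \<xi>)) *\<^sub>R \<xi> \<in> C" using neg b that by (intro cone) (simp_all add: divide_neg_neg)
    from ab(2)[OF this] neg show False by simp
  qed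
  have inner: "a \<bullet> vector [z, w] = a $ 1 \<bullet> z + a $ 2 \<bullet> w" for z w
    by (simp add: inner_vec_def sum_2)
  have "has_bochner_integral M (\<lambda>y. a $ 1 \<bullet> g1 y + a $ 2 \<bullet> g2 y) (a \<bullet> vector [z1, z2])"
    unfolding inner by (intro has_bochner_integral_add has_bochner_integral_inner_right g)
  then have "a \<bullet> vector [z1, z2] = (\<integral>y. a $ 1 \<bullet> g1 y + a $ 2 \<bullet> g2 y \<partial>M)"
    by (simp add: has_bochner_integral_integral_eq)
  also have "\<dots> \<ge> 0"
    by (rule integral_nonneg_AE) (use mem in eventually_elim, use nonneg inner in metis)
  finally show False using ab(1) b by simp
qed

text \<open>The term \<open>exp (-\<kappa>(x + y)) f(y)\<close> is subtracted from the direct part, where it leaves a nonnegative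
  weight, and added to the reflected part, where it turns \<open>s\<close> into \<open>1 + s\<close>. The factor 2 in the
  bound of the reflected part is the number of edges; it makes the total weight the kernel with mass 1.\<close>

lemma norm_resolvent_fun_le:
  assumes \<kappa>: "0 < \<kappa>" and x: "0 \<le> x" and f: "square_integrable f" "square_integrable g"
    and bound: "AE y in halfline. cmod (f y) \<le> c" "AE y in halfline. cmod (g y) \<le> c"
    and s: "cmod (1 + s) \<le> 1" "cmod s' \<le> 1"
  shows "cmod (resolvent_fun \<kappa> (s * bwd_op \<kappa> f 0 + s' * bwd_op \<kappa> g 0) f x) \<le> c"
proof -
  let ?E = "\<lambda>y. exp (- \<kappa> * \<bar>x - y\<bar>)" and ?e = "\<lambda>y. exp (- \<kappa> * (x + y))"
  let ?F = "\<lambda>y. of_real (\<kappa> / 2) * (of_real (?E y) * f y + of_real (?e y) * (s * f y + s' * g y))"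
  note F = has_bochner_integral_resolvent_fun[OF \<kappa> x f(1) f, of s s']
  note K = has_bochner_integral_mult_left[OF has_bochner_integral_total_mass[OF \<kappa> x], of c]
  have "AE y in halfline. cmod (?F y) \<le> \<kappa> / 2 * (?E y + ?e y) * c"
    using bound AE_halfline_nonneg
  proof eventually_elim
    case (elim y)
    have le: "?e y \<le> ?E y" using \<kappa> x elim(3) by (auto intro!: mult_left_mono)
    have "cmod ((1 + s) * f y) \<le> 1 * c" "cmod (s' * g y) \<le> 1 * c"
      unfolding norm_mult by (intro mult_mono s elim(1,2); simp)+
    then have h: "cmod ((1 + s) * f y + s' * g y) \<le> 2 * c"
      using norm_triangle_ineq[of "(1 + s) * f y" "s' * g y"] by linarith
    have "of_real (?E y) * f y + of_real (?e y) * (s * f y + s' * g y)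
      = of_real (?E y - ?e y) * f y + of_real (?e y) * ((1 + s) * f y + s' * g y)"
      by (simp add: algebra_simps)
    also have "cmod \<dots> \<le> cmod (of_real (?E y - ?e y) * f y) + cmod (of_real (?e y) * ((1 + s) * f y + s' * g y))"
      by (rule norm_triangle_ineq)
    also have "\<dots> = (?E y - ?e y) * cmod (f y) + ?e y * cmod ((1 + s) * f y + s' * g y)"
      using le by (simp only: norm_mult norm_of_real abs_of_nonneg diff_ge_0_iff_ge exp_ge_zero)
    also have "\<dots> \<le> (?E y - ?e y) * c + ?e y * (2 * c)"
      using le elim(1) h by (intro add_mono mult_left_mono) auto
    also have "\<dots> = (?E y + ?e y) * c" by (simp add: algebra_simps)
    finally show ?case
      using \<kappa> by (simp add: norm_mult mult.assoc)
  qed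
  then have "(\<integral>y. cmod (?F y) \<partial>halfline) \<le> (\<integral>y. \<kappa> / 2 * (?E y + ?e y) * c \<partial>halfline)"
    using F K by (intro integral_mono_AE Bochner_Integration.integrable_norm) (simp_all only: has_bochner_integral_iff)
  then have "cmod (\<integral>y. ?F y \<partial>halfline) \<le> (\<integral>y. \<kappa> / 2 * (?E y + ?e y) * c \<partial>halfline)"
    by (rule order.trans[OF integral_norm_bound])
  then show ?thesis
    unfolding has_bochner_integral_integral_eq[OF F] has_bochner_integral_integral_eq[OF K] by simp
qed

lemma Linf_norm_le_iff:
  assumes "0 \<le> c"
  shows "Linf_norm f \<le> ennreal c \<longleftrightarrow> f \<in> induced_set {\<xi>. cmod (\<xi> $ 1) \<le> c \<and> cmod (\<xi> $ 2) \<le> c}"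
proof -
  have *: "esssup halfline (\<lambda>x. ennreal (cmod (rep_l2 g x))) \<le> ennreal c \<longleftrightarrow>
    (AE x in halfline. cmod (rep_l2 g x) \<le> c)" for g
  proof
    assume le: "esssup halfline (\<lambda>x. ennreal (cmod (rep_l2 g x))) \<le> ennreal c"
    show "AE x in halfline. cmod (rep_l2 g x) \<le> c"
      using esssup_AE[of "\<lambda>x. ennreal (cmod (rep_l2 g x))" halfline]
      by eventually_elim (use le assms in \<open>auto dest: order.trans\<close>)
  next
    assume "AE x in halfline. cmod (rep_l2 g x) \<le> c"
    then show "esssup halfline (\<lambda>x. ennreal (cmod (rep_l2 g x))) \<le> ennreal c"
      by (intro esssup_I) (measurable, auto elim!: eventually_mono intro: ennreal_leI)
  qed
  show ?thesis
    by (simp add: Linf_norm_def * induced_set_def)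
qed

theorem lemma6p2:
  fixes A B :: "complex^2^2" and T :: "real \<Rightarrow> l2x2 \<Rightarrow> l2x2"
  assumes "regular A B"
    and "C0_semigroup T" and "contractive T" and "generator T = Delta A B"
  shows "(\<forall>C :: (complex^2) set. closed C \<longrightarrow> convex C \<longrightarrow>
            (\<forall>\<kappa>>0. \<forall>x1\<ge>0. \<forall>x2\<ge>0. \<forall>y1\<ge>0. \<forall>y2\<ge>0.
               leaves_invariant ((*v) (kernel_matrix \<kappa> x1 x2 y1 y2 A B)) C) \<longrightarrow>
            (\<forall>t\<ge>0. leaves_invariant (T t) (induced_set C))) \<and>
         ((\<forall>\<kappa>>0. leaves_invariant ((*v) (mat 1 + cayley (\<i> * of_real \<kappa>) A B))
               {\<xi> :: complex^2. cmod (\<xi> $ 1) + cmod (\<xi> $ 2) \<le> 1}) \<longrightarrow>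
            Linf_contractive T)"
proof (intro conjI allI impI)
  fix C :: "(complex^2) set" and t :: real
  assume C: "closed C" "convex C" and t: "0 \<le> t"
    and inv: "\<forall>\<kappa>>0. \<forall>x1\<ge>0. \<forall>x2\<ge>0. \<forall>y1\<ge>0. \<forall>y2\<ge>0.
      leaves_invariant ((*v) (kernel_matrix \<kappa> x1 x2 y1 y2 A B)) C"
  have cone: "r *\<^sub>R \<xi> \<in> C" if "0 < r" "\<xi> \<in> C" for r \<xi>
    using scaleR_mem_if_kernel_invariant[OF C(1) inv[rule_format] that(2,1)] by blast
  have "T t f \<in> induced_set C" if "f \<in> induced_set C" for f
  proof (rule semigroup_invariant_induced_set[OF assms(2-4) C(1) _ that t])
    fix \<kappa> x f1 f2
    assume *: "0 < (\<kappa> :: real)" "0 \<le> (x :: real)" "square_integrable f1" "square_integrable f2"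
      and mem: "AE y in halfline. vector [f1 y, f2 y] \<in> C"
    let ?S = "cayley (\<i> * of_real \<kappa>) A B"
    (* The half-line is not a null set, so that the empty set is excluded by the values of f. *)
    have ne: "C \<noteq> {}" using AE_halfline_const[of False] mem by auto
    have K: "AE y in halfline. vector
        [of_real (\<kappa> / 2) * (of_real (exp (- \<kappa> * \<bar>x - y\<bar>)) * f1 y
          + of_real (exp (- \<kappa> * (x + y))) * (?S $ 1 $ 1 * f1 y + ?S $ 1 $ 2 * f2 y)),
         of_real (\<kappa> / 2) * (of_real (exp (- \<kappa> * \<bar>x - y\<bar>)) * f2 y
          + of_real (exp (- \<kappa> * (x + y))) * (?S $ 2 $ 1 * f1 y + ?S $ 2 $ 2 * f2 y))] \<in> C"
      using mem AE_halfline_nonneg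
    proof eventually_elim
      case (elim y)
      have "kernel_matrix \<kappa> x x y y A B *v vector [f1 y, f2 y] \<in> C"
        using inv[rule_format, OF *(1) *(2) *(2) elim(2) elim(2)] elim(1)
        unfolding leaves_invariant_def by blast
      then show ?case
        by (simp only: kernel_matrix_mult[OF refl] vector_2 distrib_left)
    qed
    have "vector [resolvent_fun \<kappa> (?S $ 1 $ 1 * bwd_op \<kappa> f1 0 + ?S $ 1 $ 2 * bwd_op \<kappa> f2 0) f1 x,
        resolvent_fun \<kappa> (?S $ 2 $ 1 * bwd_op \<kappa> f1 0 + ?S $ 2 $ 2 * bwd_op \<kappa> f2 0) f2 x] \<in> C"
      by (rule integral_mem_closed_convex_cone[OF C cone ne has_bochner_integral_resolvent_fun[OF *(1,2,3) *(3,4)]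
        has_bochner_integral_resolvent_fun[OF *(1,2,4) *(3,4)] K])
    then show "vector [resolvent_fun \<kappa> (amplitude \<kappa> A B f1 f2 $ 1) f1 x, resolvent_fun \<kappa> (amplitude \<kappa> A B f1 f2 $ 2) f2 x] \<in> C"
      by (simp add: amplitude_def matrix_vector_mult_def sum_2)
  qed
  then show "leaves_invariant (T t) (induced_set C)"
    by (auto simp: leaves_invariant_def)
next
  assume inv: "\<forall>\<kappa>>0. leaves_invariant ((*v) (mat 1 + cayley (\<i> * of_real \<kappa>) A B))
    {\<xi> :: complex^2. cmod (\<xi> $ 1) + cmod (\<xi> $ 2) \<le> 1}"
  (* The columns of the matrix are the images of the two unit vectors. *)
  have S: "cmod (1 + cayley (\<i> * of_real \<kappa>) A B $ 1 $ 1) \<le> 1" "cmod (cayley (\<i> * of_real \<kappa>) A B $ 1 $ 2) \<le> 1"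
    "cmod (1 + cayley (\<i> * of_real \<kappa>) A B $ 2 $ 2) \<le> 1" "cmod (cayley (\<i> * of_real \<kappa>) A B $ 2 $ 1) \<le> 1"
    if "0 < \<kappa>" for \<kappa>
  proof -
    note \<kappa> = that
    let ?S = "cayley (\<i> * of_real \<kappa>) A B"
    let ?P = "mat 1 + ?S"
    have "cmod ((?P *v \<xi>) $ 1) + cmod ((?P *v \<xi>) $ 2) \<le> 1" if "cmod (\<xi> $ 1) + cmod (\<xi> $ 2) \<le> 1" for \<xi>
      using inv[rule_format, OF \<kappa>] that unfolding leaves_invariant_def by blast
    from this[of "vector [1, 0]"] this[of "vector [0, 1]"]
    have "cmod (1 + ?S $ 1 $ 1) + cmod (?S $ 2 $ 1) \<le> 1" "cmod (?S $ 1 $ 2) + cmod (1 + ?S $ 2 $ 2) \<le> 1"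
      by (simp_all add: matrix_vector_mult_def sum_2 mat_def)
    then show "cmod (1 + ?S $ 1 $ 1) \<le> 1" "cmod (?S $ 1 $ 2) \<le> 1" "cmod (1 + ?S $ 2 $ 2) \<le> 1" "cmod (?S $ 2 $ 1) \<le> 1"
      using norm_ge_zero[of "1 + ?S $ 1 $ 1"] norm_ge_zero[of "?S $ 2 $ 1"]
        norm_ge_zero[of "?S $ 1 $ 2"] norm_ge_zero[of "1 + ?S $ 2 $ 2"] by linarith+
  qed
  show "Linf_contractive T"
    unfolding Linf_contractive_def
  proof (intro allI impI)
    fix t :: real and f assume t: "0 \<le> t" and fin: "Linf_norm f < \<infinity>"
    then obtain c where c: "0 \<le> c" "Linf_norm f = ennreal c" by (cases "Linf_norm f") auto
    let ?C = "{\<xi> :: complex^2. cmod (\<xi> $ 1) \<le> c \<and> cmod (\<xi> $ 2) \<le> c}"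
    have cl: "closed ?C"
      by (intro closed_Collect_conj closed_Collect_le continuous_intros)
    have mem: "f \<in> induced_set ?C" using c(2)[THEN eq_refl] Linf_norm_le_iff[OF c(1)] by blast
    have "T t f \<in> induced_set ?C"
    proof (rule semigroup_invariant_induced_set[OF assms(2-4) cl _ mem t])
      fix \<kappa> x f1 f2
      assume *: "0 < (\<kappa> :: real)" "0 \<le> (x :: real)" "square_integrable f1" "square_integrable f2"
        and mem: "AE y in halfline. vector [f1 y, f2 y] \<in> ?C"
      from mem have b: "AE y in halfline. cmod (f1 y) \<le> c" "AE y in halfline. cmod (f2 y) \<le> c"
        by simp_all
      show "vector [resolvent_fun \<kappa> (amplitude \<kappa> A B f1 f2 $ 1) f1 x, resolvent_fun \<kappa> (amplitude \<kappa> A B f1 f2 $ 2) f2 x] \<in> ?C"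
        using norm_resolvent_fun_le[OF *(1-4) b S(1,2)[OF *(1)]] norm_resolvent_fun_le[OF *(1,2,4,3) b(2,1) S(3,4)[OF *(1)]]
        by (simp add: amplitude_def matrix_vector_mult_def sum_2 add.commute)
    qed
    then show "Linf_norm (T t f) \<le> Linf_norm f"
      unfolding c(2) using Linf_norm_le_iff[OF c(1)] by blast
  qed
qed

end
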